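(* Consider the secondary-link beamforming problem $$\max_{\mathbf{t}\in\mathbb{C}^{M_S},\ \mathbf{r}\in\mathbb{C}^{N_S},\ \|\mathbf{r}\|_2=1}\ \gamma_S(\mathbf{t},\mathbf{r})\quad\text{s.t. } (I_k)\ \text{for } k=1,\ldots,K,\quad \|\mathbf{t}\|_2^2\le P_{S,max},$$ where $\gamma_S$ is the signal to interference and noise ratio defined in the context and $(I_k)$ is the interference constraint on $\mathbf{t}$ in one of the three scenarios defined in the context. Put $$\mathbf{\Phi}=\sum_{k=1}^K\alpha_{S,k}\mathbf{h}_k\mathbf{h}_k^H+N_0\mathbf{I},\qquad \mathbf{A}=\alpha_{S,S}\mathbf{H}_{S,S}^H\mathbf{\Phi}^{-1}\mathbf{H}_{S,S}.$$ Then, in each scenario, the problem is equivalent to the homogeneous quadratically constrained quadratic program $$\max_{\mathbf{t}\in\mathbb{C}^{M_S}}\ \mathbf{t}^H\mathbf{A}\mathbf{t}\quad\text{s.t. }\mathbf{t}^H\mathbf{Q}_k\mathbf{t}\le 1\ (k=1,\ldots,K),\quad \mathbf{t}^H\mathbf{t}\le P_{S,max},$$ in the following sense. (a) For every $\mathbf{t}\in\mathbb{C}^{M_S}$, $\max_{\|\mathbf{r}\|_2=1}\gamma_S(\mathbf{t},\mathbf{r})=\mathbf{t}^H\mathbf{A}\mathbf{t}$, and if $\mathbf{H}_{S,S}\mathbf{t}\neq\mathbf{0}$ the maximum is attained at $\mathbf{r}=\mathbf{\Phi}^{-1}\mathbf{H}_{S,S}\mathbf{t}/\|\mathbf{\Phi}^{-1}\mathbf{H}_{S,S}\mathbf{t}\|_2$.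 (b) For every $\mathbf{t}\in\mathbb{C}^{M_S}$ and every $k$, the constraint $(I_k)$ holds if and only if $\mathbf{t}^H\mathbf{Q}_k\mathbf{t}\le1$, where - in Scenario 1, $\mathbf{Q}_k=\frac{\alpha_{k,S}}{\epsilon_k}\mathbf{H}_{k,S}^H\mathbf{r}_k\mathbf{r}_k^H\mathbf{H}_{k,S}$; - in Scenario 2, $\mathbf{Q}_k=\frac{1-\delta_k^{1/(N_k-1)}}{\epsilon_k}\alpha_{k,S}\mathbf{H}_{k,S}^H\mathbf{H}_{k,S}$; - in Scenario 3, $\mathbf{Q}_k=\frac{\alpha_{k,S}}{\epsilon_k}\log\frac{1}{\delta_k}\,\mathbf{I}$.
   Context: Data: positive integers $K,M_S,N_S,N_1,\ldots,N_K$; positive reals $\alpha_{S,S},\alpha_{S,k},\alpha_{k,S},\epsilon_k$ ($k=1,\ldots,K$), $N_0$, $P_{S,max}$; a given matrix $\mathbf{H}_{S,S}\in\mathbb{C}^{N_S\times M_S}$ and given vectors $\mathbf{h}_k\in\mathbb{C}^{N_S}$ (in the application $\mathbf{h}_k=\mathbf{H}_{S,k}\mathbf{t}_k$, the channel from the $k$th primary transmitter to the secondary receiver times the $k$th primary transmit beamformer). $(\cdot)^H$ is conjugate transpose; $\log$ is the natural logarithm. For $\mathbf{r}$ with $\|\mathbf{r}\|_2=1$, $$\gamma_S(\mathbf{t},\mathbf{r})=\frac{\alpha_{S,S}|\mathbf{r}^H\mathbf{H}_{S,S}\mathbf{t}|^2}{\sum_{k=1}^K\alpha_{S,k}|\mathbf{r}^H\mathbf{h}_k|^2+N_0}.$$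 $\mathbf{H}_{k,S}\in\mathbb{C}^{N_k\times M_S}$ is the channel matrix from the secondary transmitter to the $k$th primary receiver, and $\mathbf{r}_k\in\mathbb{C}^{N_k}$ with $\|\mathbf{r}_k\|_2=1$ is the $k$th primary receive beamformer. The constraints $(I_k)$ are: Scenario 1: $\mathbf{H}_{k,S}$ and $\mathbf{r}_k$ are given (deterministic), and $(I_k)$ is $\alpha_{k,S}|\mathbf{r}_k^H\mathbf{H}_{k,S}\mathbf{t}|^2\le\epsilon_k$. Scenario 2: $\mathbf{H}_{k,S}$ is given, $N_k\ge2$, and $\mathbf{r}_k$ is random, distributed as $\mathbf{z}/\|\mathbf{z}\|_2$ with $\mathbf{z}\sim\mathcal{CN}(\mathbf{0},\mathbf{I})$ in $\mathbb{C}^{N_k}$ (i.e. uniformly on the complex unit sphere); $\delta_k\in(0,1)$; $(I_k)$ is $\Pr_{\mathbf{r}_k}\{\alpha_{k,S}|\mathbf{r}_k^H\mathbf{H}_{k,S}\mathbf{t}|^2\le\epsilon_k\}\ge1-\delta_k$. Scenario 3: $\mathbf{H}_{k,S}$ is random with i.i.d. $\mathcal{CN}(0,1)$ entries (circularly symmetric complex Gaussian, mean zero, variance $1$), $\mathbf{r}_k$ is a random unit vector independent of $\mathbf{H}_{k,S}$; $\delta_k\in(0,1)$; $(I_k)$ is $\Pr_{\mathbf{r}_k,\mathbf{H}_{k,S}}\{\alpha_{k,S}|\mathbf{r}_k^H\mathbf{H}_{k,S}\mathbf{t}|^2\le\epsilon_k\}\ge1-\delta_k$. *)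

theory Defs
  imports
    "HOL-Probability.Probability"
    "Jordan_Normal_Form.Schur_Decomposition"
    "Jordan_Normal_Form.Gauss_Jordan_Elimination"
begin

(* Vectors and matrices are those of Jordan_Normal_Form, because the dimensions N k depend
   on the index k. There v \<bullet>c r = (\<Sum>i. v $ i * cnj (r $ i)), so that the product r^H v of
   the mathematical notation is v \<bullet>c r. *)

unbundle no vec_syntax
hide_const (open) Finite_Cartesian_Product.mat Finite_Cartesian_Product.vec
hide_type (open) Finite_Cartesian_Product.vec

section \<open>Linear algebra\<close>

definition l2norm :: "complex vec \<Rightarrow> real" where
  "l2norm v = L2_set (\<lambda>i. cmod (v $ i)) {..<dim_vec v}"

definition unit_sphere :: "nat \<Rightarrow> complex vec set" where
  "unit_sphere n = {r \<in> carrier_vec n. l2norm r = 1}"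

text \<open>The rank-one matrix \<open>v v\<^sup>H\<close>.\<close>
definition outer :: "complex vec \<Rightarrow> complex mat" where
  "outer v = mat (dim_vec v) (dim_vec v) (\<lambda>(i, j). v $ i * cnj (v $ j))"

text \<open>The form \<open>t\<^sup>H Q t\<close>. It is complex valued; inequalities between such values below are in
  the order of \<open>Complex_Order\<close>, where \<open>z \<le> 1\<close> includes that \<open>z\<close> is real.\<close>
definition quad_form :: "complex mat \<Rightarrow> complex vec \<Rightarrow> complex" where
  "quad_form Q t = (Q *\<^sub>v t) \<bullet>c t"

text \<open>Meaningful for invertible matrices only.\<close>
definition minv :: "complex mat \<Rightarrow> complex mat" where
  "minv B = the (mat_inverse B)"

section \<open>The beamforming problem\<close>

definition sinr ::
  "nat \<Rightarrow> real \<Rightarrow> (nat \<Rightarrow> real) \<Rightarrow> real \<Rightarrow> complex mat \<Rightarrow> (nat \<Rightarrow> complex vec)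
    \<Rightarrow> complex vec \<Rightarrow> complex vec \<Rightarrow> real" where
  "sinr K aSS aS N0 HSS h t r =
     aSS * (cmod ((HSS *\<^sub>v t) \<bullet>c r))\<^sup>2 / ((\<Sum>k = 1..K. aS k * (cmod (h k \<bullet>c r))\<^sup>2) + N0)"

text \<open>Matrices of variable size form no additive monoid type, hence the sum of the
  \<open>N\<^sub>S \<times> N\<^sub>S\<close> matrices is taken entrywise.\<close>
definition Phi_mat ::
  "nat \<Rightarrow> nat \<Rightarrow> (nat \<Rightarrow> real) \<Rightarrow> real \<Rightarrow> (nat \<Rightarrow> complex vec) \<Rightarrow> complex mat" where
  "Phi_mat nS K aS N0 h =
     mat nS nS (\<lambda>ij. \<Sum>k = 1..K. (complex_of_real (aS k) \<cdot>\<^sub>m outer (h k)) $$ ij)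
       + complex_of_real N0 \<cdot>\<^sub>m 1\<^sub>m nS"

definition A_mat :: "real \<Rightarrow> complex mat \<Rightarrow> complex mat \<Rightarrow> complex mat" where
  "A_mat aSS HSS \<Phi> = complex_of_real aSS \<cdot>\<^sub>m (mat_adjoint HSS * minv \<Phi> * HSS)"

text \<open>Feasible sets of the two problems; \<open>I k t\<close> is the interference constraint.\<close>
definition bf_feasible ::
  "nat \<Rightarrow> nat \<Rightarrow> nat \<Rightarrow> real \<Rightarrow> (nat \<Rightarrow> complex vec \<Rightarrow> bool) \<Rightarrow> complex vec \<times> complex vec \<Rightarrow> bool" where
  "bf_feasible mS nS K Pmax I = (\<lambda>(t, r). t \<in> carrier_vec mS \<and> r \<in> unit_sphere nS \<and>
     (\<forall>k\<in>{1..K}. I k t) \<and> (l2norm t)\<^sup>2 \<le> Pmax)"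

definition qcqp_feasible ::
  "nat \<Rightarrow> nat \<Rightarrow> real \<Rightarrow> (nat \<Rightarrow> complex mat) \<Rightarrow> complex vec \<Rightarrow> bool" where
  "qcqp_feasible mS K Pmax Q t \<longleftrightarrow> t \<in> carrier_vec mS \<and>
     (\<forall>k\<in>{1..K}. quad_form (Q k) t \<le> 1) \<and> t \<bullet>c t \<le> complex_of_real Pmax"

text \<open>Equality of the maximizing \<open>t\<close> and of the maximal values.\<close>
definition same_solutions ::
  "nat \<Rightarrow> nat \<Rightarrow> nat \<Rightarrow> real \<Rightarrow> (complex vec \<Rightarrow> complex vec \<Rightarrow> real) \<Rightarrow> complex mat
    \<Rightarrow> (nat \<Rightarrow> complex vec \<Rightarrow> bool) \<Rightarrow> (nat \<Rightarrow> complex mat) \<Rightarrow> bool" where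
  "same_solutions mS nS K Pmax \<gamma> A I Q \<longleftrightarrow>
     (\<forall>t. (\<exists>r. is_arg_max (\<lambda>(t, r). \<gamma> t r) (bf_feasible mS nS K Pmax I) (t, r)) \<longleftrightarrow>
          is_arg_max (\<lambda>t. Re (quad_form A t)) (qcqp_feasible mS K Pmax Q) t) \<and>
     (\<forall>t r. is_arg_max (\<lambda>(t, r). \<gamma> t r) (bf_feasible mS nS K Pmax I) (t, r) \<longrightarrow>
          complex_of_real (\<gamma> t r) = quad_form A t)"

section \<open>Random vectors and matrices\<close>

text \<open>\<open>CN(0,1)\<close>: independent real and imaginary parts, each normal with mean 0 and variance
  \<open>1/2\<close> (the second argument of \<open>normal_density\<close> is the standard deviation).\<close>
definition cnormal :: "complex measure" where
  "cnormal =
     distr (density lborel (\<lambda>x. ennreal (normal_density 0 (sqrt (1/2)) x)) \<Otimes>\<^sub>M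
            density lborel (\<lambda>x. ennreal (normal_density 0 (sqrt (1/2)) x)))
       borel (\<lambda>(x, y). Complex x y)"

text \<open>Jordan_Normal_Form vectors and matrices carry no Borel structure; their laws and
  independence are expressed through their coordinate families in product spaces.\<close>
definition vec_coords :: "nat \<Rightarrow> complex vec \<Rightarrow> nat \<Rightarrow> complex" where
  "vec_coords n v = (\<lambda>i\<in>{..<n}. v $ i)"

definition mat_coords :: "nat \<Rightarrow> nat \<Rightarrow> complex mat \<Rightarrow> nat \<times> nat \<Rightarrow> complex" where
  "mat_coords m n B = (\<lambda>ij\<in>{..<m} \<times> {..<n}. B $$ ij)"

abbreviation vec_space :: "nat \<Rightarrow> (nat \<Rightarrow> complex) measure" where
  "vec_space n \<equiv> PiM {..<n} (\<lambda>_. borel)"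

abbreviation mat_space :: "nat \<Rightarrow> nat \<Rightarrow> (nat \<times> nat \<Rightarrow> complex) measure" where
  "mat_space m n \<equiv> PiM ({..<m} \<times> {..<n}) (\<lambda>_. borel)"

definition random_vec :: "'w measure \<Rightarrow> nat \<Rightarrow> ('w \<Rightarrow> complex vec) \<Rightarrow> bool" where
  "random_vec M n X \<longleftrightarrow> (\<forall>\<omega>\<in>space M. X \<omega> \<in> carrier_vec n) \<and>
     (\<lambda>\<omega>. vec_coords n (X \<omega>)) \<in> measurable M (vec_space n)"

definition random_mat :: "'w measure \<Rightarrow> nat \<Rightarrow> nat \<Rightarrow> ('w \<Rightarrow> complex mat) \<Rightarrow> bool" where
  "random_mat M m n X \<longleftrightarrow> (\<forall>\<omega>\<in>space M. X \<omega> \<in> carrier_mat m n) \<and>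
     (\<lambda>\<omega>. mat_coords m n (X \<omega>)) \<in> measurable M (mat_space m n)"

text \<open>The law of \<open>z / \<parallel>z\<parallel>\<^sub>2\<close> for \<open>z\<close> distributed as \<open>CN(0, I)\<close> in dimension \<open>n\<close>.\<close>
definition sphere_law :: "nat \<Rightarrow> (nat \<Rightarrow> complex) measure" where
  "sphere_law n = distr (PiM {..<n} (\<lambda>_. cnormal)) (vec_space n)
     (\<lambda>z. \<lambda>i\<in>{..<n}. z i / complex_of_real (L2_set (\<lambda>j. cmod (z j)) {..<n}))"

definition isotropic_unit_vec :: "'w measure \<Rightarrow> nat \<Rightarrow> ('w \<Rightarrow> complex vec) \<Rightarrow> bool" where
  "isotropic_unit_vec M n X \<longleftrightarrow> random_vec M n X \<and>
     distr M (vec_space n) (\<lambda>\<omega>. vec_coords n (X \<omega>)) = sphere_law n"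

definition iid_cnormal_mat :: "'w measure \<Rightarrow> nat \<Rightarrow> nat \<Rightarrow> ('w \<Rightarrow> complex mat) \<Rightarrow> bool" where
  "iid_cnormal_mat M m n X \<longleftrightarrow> random_mat M m n X \<and>
     prob_space.indep_vars M (\<lambda>_. borel) (\<lambda>ij \<omega>. X \<omega> $$ ij) ({..<m} \<times> {..<n}) \<and>
     (\<forall>ij \<in> {..<m} \<times> {..<n}. distr M borel (\<lambda>\<omega>. X \<omega> $$ ij) = cnormal)"

text \<open>Independence of the generated sigma-algebras; \<open>indep_var\<close> would require both random
  variables to have values in the same type.\<close>
definition indep_mat_vec ::
  "'w measure \<Rightarrow> nat \<Rightarrow> nat \<Rightarrow> ('w \<Rightarrow> complex mat) \<Rightarrow> ('w \<Rightarrow> complex vec) \<Rightarrow> bool" where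
  "indep_mat_vec M m n X Y \<longleftrightarrow>
     prob_space.indep_set M
       (sets (vimage_algebra (space M) (\<lambda>\<omega>. mat_coords m n (X \<omega>)) (mat_space m n)))
       (sets (vimage_algebra (space M) (\<lambda>\<omega>. vec_coords m (Y \<omega>)) (vec_space m)))"

section \<open>The interference constraints\<close>

definition interference :: "real \<Rightarrow> complex mat \<Rightarrow> complex vec \<Rightarrow> complex vec \<Rightarrow> real" where
  "interference a H r t = a * (cmod ((H *\<^sub>v t) \<bullet>c r))\<^sup>2"

definition constraint1 ::
  "(nat \<Rightarrow> real) \<Rightarrow> (nat \<Rightarrow> real) \<Rightarrow> (nat \<Rightarrow> complex mat) \<Rightarrow> (nat \<Rightarrow> complex vec)
    \<Rightarrow> nat \<Rightarrow> complex vec \<Rightarrow> bool" where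
  "constraint1 a \<epsilon> H r k t \<longleftrightarrow> interference (a k) (H k) (r k) t \<le> \<epsilon> k"

definition constraint2 ::
  "'w measure \<Rightarrow> (nat \<Rightarrow> real) \<Rightarrow> (nat \<Rightarrow> real) \<Rightarrow> (nat \<Rightarrow> real) \<Rightarrow> (nat \<Rightarrow> complex mat)
    \<Rightarrow> (nat \<Rightarrow> 'w \<Rightarrow> complex vec) \<Rightarrow> nat \<Rightarrow> complex vec \<Rightarrow> bool" where
  "constraint2 M a \<epsilon> \<delta> H R k t \<longleftrightarrow>
     \<P>(\<omega> in M. interference (a k) (H k) (R k \<omega>) t \<le> \<epsilon> k) \<ge> 1 - \<delta> k"

definition constraint3 ::
  "'w measure \<Rightarrow> (nat \<Rightarrow> real) \<Rightarrow> (nat \<Rightarrow> real) \<Rightarrow> (nat \<Rightarrow> real) \<Rightarrow> (nat \<Rightarrow> 'w \<Rightarrow> complex mat)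
    \<Rightarrow> (nat \<Rightarrow> 'w \<Rightarrow> complex vec) \<Rightarrow> nat \<Rightarrow> complex vec \<Rightarrow> bool" where
  "constraint3 M a \<epsilon> \<delta> G R k t \<longleftrightarrow>
     \<P>(\<omega> in M. interference (a k) (G k \<omega>) (R k \<omega>) t \<le> \<epsilon> k) \<ge> 1 - \<delta> k"

definition Q1 ::
  "(nat \<Rightarrow> real) \<Rightarrow> (nat \<Rightarrow> real) \<Rightarrow> (nat \<Rightarrow> complex mat) \<Rightarrow> (nat \<Rightarrow> complex vec)
    \<Rightarrow> nat \<Rightarrow> complex mat" where
  "Q1 a \<epsilon> H r k =
     complex_of_real (a k / \<epsilon> k) \<cdot>\<^sub>m (mat_adjoint (H k) * outer (r k) * H k)"

definition Q2 ::
  "(nat \<Rightarrow> nat) \<Rightarrow> (nat \<Rightarrow> real) \<Rightarrow> (nat \<Rightarrow> real) \<Rightarrow> (nat \<Rightarrow> real) \<Rightarrow> (nat \<Rightarrow> complex mat)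
    \<Rightarrow> nat \<Rightarrow> complex mat" where
  "Q2 N a \<epsilon> \<delta> H k =
     complex_of_real ((1 - \<delta> k powr (1 / (real (N k) - 1))) / \<epsilon> k * a k)
       \<cdot>\<^sub>m (mat_adjoint (H k) * H k)"

definition Q3 ::
  "nat \<Rightarrow> (nat \<Rightarrow> real) \<Rightarrow> (nat \<Rightarrow> real) \<Rightarrow> (nat \<Rightarrow> real) \<Rightarrow> nat \<Rightarrow> complex mat" where
  "Q3 mS a \<epsilon> \<delta> k = complex_of_real (a k / \<epsilon> k * ln (1 / \<delta> k)) \<cdot>\<^sub>m 1\<^sub>m mS"

end

theory Submission
  imports Defs
begin

text \<open>
  Part (a) is the Cauchy--Schwarz inequality for the positive definite form
  \<open>u\<^sup>H \<Phi> w = \<Sum>\<^sub>k \<alpha>\<^sub>k (u\<^sup>H h\<^sub>k) (h\<^sub>k\<^sup>H w) + N\<^sub>0 u\<^sup>H w\<close>: for \<open>w = \<Phi>\<^sup>-\<^sup>1 H t\<close> the numerator of the SINR is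
  \<open>\<alpha>\<^sub>S |u\<^sup>H \<Phi> w|\<^sup>2\<close> and, on the unit sphere, the denominator is \<open>u\<^sup>H \<Phi> u\<close>.

  Part (b) rests on the unitary invariance of the complex Gaussian law in the following form: the
  pair \<open>(\<Sum>\<^sub>j v\<^sub>j z\<^sub>j, \<Sum>\<^sub>j |z\<^sub>j|\<^sup>2)\<close> has the law of \<open>(\<parallel>v\<parallel> w, |w|\<^sup>2 + S)\<close> with \<open>w\<close> Gaussian and
  independent of \<open>S\<close>, the sum of the squares of the remaining coordinates. It follows by induction
  from plane rotations. Since \<open>|w|\<^sup>2\<close> is exponential with mean 1, Scenario 3 (conditionally on the
  receive beamformer) gives the tail \<open>exp (- q / \<parallel>t\<parallel>\<^sup>2)\<close>. In Scenario 2 the tail is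
  \<open>P (|w|\<^sup>2 > c S) = E exp (- c S) = 1 / (1 + c)\<^sup>N\<^sup>-\<^sup>1 = (1 - x)\<^sup>N\<^sup>-\<^sup>1\<close> with \<open>x = q / \<parallel>v\<parallel>\<^sup>2 < 1\<close> and
  \<open>c = x / (1 - x)\<close>.
\<close>

section \<open>Rotation invariance of the complex Gaussian law\<close>

text \<open>For \<open>c \<noteq> 0\<close> the rotation is a composition of two one-variable affine
  substitutions separated by Fubini: the first makes the first coordinate the integration variable
  and contributes the Jacobian \<open>\<bar>1 / c\<bar>\<close>, the second, in the other variable,
  absorbs it. For \<open>c = 0\<close> the map is a quarter turn, a swap of the variables with
  signs.\<close>

lemma nn_integral_lborel_rotation:
  fixes f :: "real \<times> real \<Rightarrow> ennreal"
  assumes [measurable]: "f \<in> borel_measurable (borel \<Otimes>\<^sub>M borel)"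
    and cs: "c\<^sup>2 + s\<^sup>2 = 1"
  shows "(\<integral>\<^sup>+x. \<integral>\<^sup>+y. f (c * x + s * y, c * y - s * x) \<partial>lborel \<partial>lborel) =
         (\<integral>\<^sup>+x. \<integral>\<^sup>+y. f (x, y) \<partial>lborel \<partial>lborel)"
proof (cases "c = 0")
  case True
  then have s: "s \<noteq> 0" "\<bar>s\<bar> = 1" using cs by (auto simp: power2_eq_1_iff abs_if)
  have "(\<integral>\<^sup>+x. \<integral>\<^sup>+y. f (s * y, - s * x) \<partial>lborel \<partial>lborel) =
    (\<integral>\<^sup>+x. (\<integral>\<^sup>+y. f (y, - s * x) \<partial>lborel) \<partial>lborel)"
  proof (rule nn_integral_cong)
    fix x
    show "(\<integral>\<^sup>+y. f (s * y, - s * x) \<partial>lborel) = (\<integral>\<^sup>+y. f (y, - s * x) \<partial>lborel)"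
      using nn_integral_real_affine[of "\<lambda>y. f (y, - s * x)" s 0] s by simp
  qed
  also have "\<dots> = (\<integral>\<^sup>+y. \<integral>\<^sup>+x. f (y, - s * x) \<partial>lborel \<partial>lborel)"
    by (rule lborel_pair.Fubini') measurable
  also have "\<dots> = (\<integral>\<^sup>+y. \<integral>\<^sup>+x. f (y, x) \<partial>lborel \<partial>lborel)"
  proof (rule nn_integral_cong)
    fix y
    show "(\<integral>\<^sup>+x. f (y, - s * x) \<partial>lborel) = (\<integral>\<^sup>+x. f (y, x) \<partial>lborel)"
      using nn_integral_real_affine[of "\<lambda>x. f (y, x)" "- s" 0] s by simp
  qed
  finally show ?thesis using True by simp
next
  case c: False
  \<comment> \<open>The second coordinate once the first has become the integration variable; here
    \<open>c\<^sup>2 + s\<^sup>2 = 1\<close> enters.\<close>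
  have e: "c * x - s * (y / c - s / c * x) = - s / c * y + 1 / c * x" for x y
  proof -
    have "c * x - s * (y / c - s / c * x) = (c\<^sup>2 + s\<^sup>2) * x / c - s / c * y"
      using c by (simp add: field_simps power2_eq_square)
    then show ?thesis using cs by simp
  qed
  have "(\<integral>\<^sup>+x. \<integral>\<^sup>+y. f (c * x + s * y, c * y - s * x) \<partial>lborel \<partial>lborel) =
    (\<integral>\<^sup>+y. \<integral>\<^sup>+x. f (c * x + s * y, c * y - s * x) \<partial>lborel \<partial>lborel)"
    by (rule lborel_pair.Fubini') measurable
  also have "\<dots> = (\<integral>\<^sup>+y. \<integral>\<^sup>+x. ennreal \<bar>1 / c\<bar> * f (x, - s / c * x + 1 / c * y) \<partial>lborel \<partial>lborel)"
  proof (rule nn_integral_cong)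
    fix y
    have "(\<integral>\<^sup>+x. f (c * x + s * y, c * y - s * x) \<partial>lborel) = ennreal \<bar>1 / c\<bar> *
        (\<integral>\<^sup>+x. f (c * (- s * y / c + 1 / c * x) + s * y, c * y - s * (- s * y / c + 1 / c * x)) \<partial>lborel)"
      using c by (intro nn_integral_real_affine) auto
    also have "\<dots> = (\<integral>\<^sup>+x. ennreal \<bar>1 / c\<bar> * f (x, - s / c * x + 1 / c * y) \<partial>lborel)"
    proof -
      have "c * (- s * y / c + 1 / c * x) + s * y = x"
        "c * y - s * (- s * y / c + 1 / c * x) = - s / c * x + 1 / c * y" for x
        using c e[of y x] by (simp_all add: algebra_simps)
      then show ?thesis by (simp add: nn_integral_cmult)
    qed
    finally show "(\<integral>\<^sup>+x. f (c * x + s * y, c * y - s * x) \<partial>lborel) =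
      (\<integral>\<^sup>+x. ennreal \<bar>1 / c\<bar> * f (x, - s / c * x + 1 / c * y) \<partial>lborel)" .
  qed
  also have "\<dots> = (\<integral>\<^sup>+x. \<integral>\<^sup>+y. ennreal \<bar>1 / c\<bar> * f (x, - s / c * x + 1 / c * y) \<partial>lborel \<partial>lborel)"
    by (rule lborel_pair.Fubini') measurable
  also have "\<dots> = (\<integral>\<^sup>+x. \<integral>\<^sup>+y. f (x, y) \<partial>lborel \<partial>lborel)"
  proof (rule nn_integral_cong)
    fix x
    have "(\<integral>\<^sup>+y. f (x, y) \<partial>lborel) = ennreal \<bar>1 / c\<bar> * (\<integral>\<^sup>+y. f (x, - s / c * x + 1 / c * y) \<partial>lborel)"
      using c by (intro nn_integral_real_affine) auto
    then show "(\<integral>\<^sup>+y. ennreal \<bar>1 / c\<bar> * f (x, - s / c * x + 1 / c * y) \<partial>lborel) = (\<integral>\<^sup>+y. f (x, y) \<partial>lborel)"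
      by (simp add: nn_integral_cmult)
  qed
  finally show ?thesis .
qed

section \<open>Gaussian integrals in real and complex coordinates\<close>

abbreviation half_normal :: "real measure" where
  "half_normal \<equiv> density lborel (\<lambda>x. ennreal (normal_density 0 (sqrt (1/2)) x))"

lemma normal_density_half: "normal_density 0 (sqrt (1/2)) x = exp (- x\<^sup>2) / sqrt pi"
  by (simp add: normal_density_def)

lemma prob_space_half_normal: "prob_space half_normal"
  by (rule prob_space_normal_density) simp

text \<open>The normalizing factors \<open>1 / sqrt pi\<close> multiply to \<open>1 / pi\<close>,
  and the resulting plane density depends on the radius alone.\<close>

lemma nn_integral_half_normal2:
  fixes f :: "real \<times> real \<Rightarrow> ennreal"
  assumes [measurable]: "f \<in> borel_measurable (borel \<Otimes>\<^sub>M borel)"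
  shows "(\<integral>\<^sup>+x. \<integral>\<^sup>+y. f (x, y) \<partial>half_normal \<partial>half_normal) =
    (\<integral>\<^sup>+x. \<integral>\<^sup>+y. ennreal (exp (- (x\<^sup>2 + y\<^sup>2)) / pi) * f (x, y) \<partial>lborel \<partial>lborel)"
proof -
  have e: "ennreal (exp (- x\<^sup>2) / sqrt pi) * (ennreal (exp (- y\<^sup>2) / sqrt pi) * a) =
      ennreal (exp (- (x\<^sup>2 + y\<^sup>2)) / pi) * a" for x y and a :: ennreal
    by (simp add: ennreal_mult[symmetric] mult.assoc[symmetric] exp_add[symmetric])
  show ?thesis
    by (simp add: nn_integral_density normal_density_half nn_integral_cmult[symmetric] e)
qed

text \<open>The radial density is moved into the integrand \<open>F\<close>; since the rotation
  preserves \<open>x\<^sup>2 + y\<^sup>2\<close>, the invariance of Lebesgue measure applies to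
  \<open>F\<close>.\<close>

lemma nn_integral_half_normal_rotation:
  fixes f :: "real \<times> real \<Rightarrow> ennreal"
  assumes [measurable]: "f \<in> borel_measurable (borel \<Otimes>\<^sub>M borel)"
    and cs: "c\<^sup>2 + s\<^sup>2 = 1"
  shows "(\<integral>\<^sup>+x. \<integral>\<^sup>+y. f (c * x + s * y, c * y - s * x) \<partial>half_normal \<partial>half_normal) =
         (\<integral>\<^sup>+x. \<integral>\<^sup>+y. f (x, y) \<partial>half_normal \<partial>half_normal)"
proof -
  define F where "F = (\<lambda>p. ennreal (exp (- ((fst p)\<^sup>2 + (snd p)\<^sup>2)) / pi) * f p)"
  have [measurable]: "F \<in> borel_measurable (borel \<Otimes>\<^sub>M borel)"
    unfolding F_def by measurable
  have "(c * x + s * y)\<^sup>2 + (c * y - s * x)\<^sup>2 = x\<^sup>2 + y\<^sup>2" for x y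
  proof -
    have "(c * x + s * y)\<^sup>2 + (c * y - s * x)\<^sup>2 = (c\<^sup>2 + s\<^sup>2) * (x\<^sup>2 + y\<^sup>2)"
      by (simp add: power2_eq_square algebra_simps)
    then show ?thesis by (simp add: cs)
  qed
  then have e: "- (c * x + s * y)\<^sup>2 - (c * y - s * x)\<^sup>2 = - x\<^sup>2 - y\<^sup>2" for x y
    by (smt (verit))
  have "(\<integral>\<^sup>+x. \<integral>\<^sup>+y. f (c * x + s * y, c * y - s * x) \<partial>half_normal \<partial>half_normal) =
     (\<integral>\<^sup>+x. \<integral>\<^sup>+y. F (c * x + s * y, c * y - s * x) \<partial>lborel \<partial>lborel)"
    using nn_integral_half_normal2[of "\<lambda>p. f (c * fst p + s * snd p, c * snd p - s * fst p)"]
    by (simp add: F_def e)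
  also have "\<dots> = (\<integral>\<^sup>+x. \<integral>\<^sup>+y. F (x, y) \<partial>lborel \<partial>lborel)"
    by (rule nn_integral_lborel_rotation[OF _ cs]) measurable
  also have "\<dots> = (\<integral>\<^sup>+x. \<integral>\<^sup>+y. f (x, y) \<partial>half_normal \<partial>half_normal)"
    by (simp add: nn_integral_half_normal2 F_def)
  finally show ?thesis .
qed

lemma measurable_Complex[measurable (raw)]:
  assumes [measurable]: "f \<in> borel_measurable M" "g \<in> borel_measurable M"
  shows "(\<lambda>x. Complex (f x) (g x)) \<in> borel_measurable M"
  unfolding Complex_eq by measurable

lemma sets_cnormal[measurable_cong, simp]: "sets cnormal = sets borel"
  and space_cnormal[simp]: "space cnormal = UNIV"
  by (simp_all add: cnormal_def)

lemma prob_space_cnormal: "prob_space cnormal"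
proof -
  interpret prob_space half_normal by (rule prob_space_half_normal)
  interpret pair_prob_space half_normal half_normal ..
  show ?thesis unfolding cnormal_def by (rule prob_space_distr) measurable
qed

lemma nn_integral_cnormal:
  assumes [measurable]: "f \<in> borel_measurable borel"
  shows "(\<integral>\<^sup>+w. f w \<partial>cnormal) = (\<integral>\<^sup>+x. \<integral>\<^sup>+y. f (Complex x y) \<partial>half_normal \<partial>half_normal)"
proof -
  interpret prob_space half_normal by (rule prob_space_half_normal)
  have "(\<integral>\<^sup>+w. f w \<partial>cnormal) = (\<integral>\<^sup>+p. f (Complex (fst p) (snd p)) \<partial>(half_normal \<Otimes>\<^sub>M half_normal))"
    unfolding cnormal_def by (subst nn_integral_distr) (auto simp: case_prod_beta)
  also have "\<dots> = (\<integral>\<^sup>+x. \<integral>\<^sup>+y. f (Complex x y) \<partial>half_normal \<partial>half_normal)"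
    using nn_integral_fst[of "\<lambda>p. f (Complex (fst p) (snd p))" half_normal] by simp
  finally show ?thesis .
qed

text \<open>Multiplication by \<open>a\<close> rotates the plane of real and imaginary parts, with
  \<open>c = Re a\<close> and \<open>s = - Im a\<close> in the convention
  \<open>(c * x + s * y, c * y - s * x)\<close>.\<close>

lemma nn_integral_cnormal_phase:
  assumes [measurable]: "f \<in> borel_measurable borel" and a: "cmod a = 1"
  shows "(\<integral>\<^sup>+w. f (a * w) \<partial>cnormal) = (\<integral>\<^sup>+w. f w \<partial>cnormal)"
proof -
  have cs: "(Re a)\<^sup>2 + (- Im a)\<^sup>2 = 1" using a by (simp add: cmod_def)
  have "a * Complex x y = Complex (Re a * x + - Im a * y) (Re a * y - - Im a * x)" for x y
    by (simp add: complex_eq_iff algebra_simps)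
  then have "(\<integral>\<^sup>+w. f (a * w) \<partial>cnormal) = (\<integral>\<^sup>+x. \<integral>\<^sup>+y. f (Complex (Re a * x + - Im a * y) (Re a * y - - Im a * x)) \<partial>half_normal \<partial>half_normal)"
    by (simp add: nn_integral_cnormal)
  also have "\<dots> = (\<integral>\<^sup>+x. \<integral>\<^sup>+y. f (Complex x y) \<partial>half_normal \<partial>half_normal)"
    using nn_integral_half_normal_rotation[of "\<lambda>p. f (Complex (fst p) (snd p))", OF _ cs] by simp
  finally show ?thesis by (simp add: nn_integral_cnormal)
qed

text \<open>A rotation with real coefficients mixes real parts only with real parts and imaginary
  parts only with imaginary parts, so the real rotation lemma is applied once to each pair.\<close>

lemma nn_integral_cnormal_rotation:
  fixes f :: "complex \<times> complex \<Rightarrow> ennreal"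
  assumes [measurable]: "f \<in> borel_measurable (borel \<Otimes>\<^sub>M borel)"
    and cs: "c\<^sup>2 + s\<^sup>2 = 1"
  shows "(\<integral>\<^sup>+w. \<integral>\<^sup>+z. f (of_real c * w + of_real s * z, of_real c * z - of_real s * w) \<partial>cnormal \<partial>cnormal) =
         (\<integral>\<^sup>+w. \<integral>\<^sup>+z. f (w, z) \<partial>cnormal \<partial>cnormal)"
proof -
  interpret H: prob_space half_normal by (rule prob_space_half_normal)
  interpret C: prob_space cnormal by (rule prob_space_cnormal)
  interpret pair_sigma_finite half_normal half_normal ..
  \<comment> \<open>Exchanging the two middle integrals brings together the variables that the
    rotation mixes: real parts outside, imaginary parts inside.\<close>
  have unfold: "(\<integral>\<^sup>+w. \<integral>\<^sup>+z. F (w, z) \<partial>cnormal \<partial>cnormal) =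
    (\<integral>\<^sup>+x. \<integral>\<^sup>+x'. \<integral>\<^sup>+y. \<integral>\<^sup>+y'. F (Complex x y, Complex x' y') \<partial>half_normal \<partial>half_normal \<partial>half_normal \<partial>half_normal)"
    if [measurable]: "F \<in> borel_measurable (borel \<Otimes>\<^sub>M borel)" for F :: "complex \<times> complex \<Rightarrow> ennreal"
  proof -
    have "(\<integral>\<^sup>+w. \<integral>\<^sup>+z. F (w, z) \<partial>cnormal \<partial>cnormal) =
      (\<integral>\<^sup>+x. \<integral>\<^sup>+y. \<integral>\<^sup>+x'. \<integral>\<^sup>+y'. F (Complex x y, Complex x' y') \<partial>half_normal \<partial>half_normal \<partial>half_normal \<partial>half_normal)"
      by (simp add: nn_integral_cnormal)
    also have "\<dots> = (\<integral>\<^sup>+x. \<integral>\<^sup>+x'. \<integral>\<^sup>+y. \<integral>\<^sup>+y'. F (Complex x y, Complex x' y') \<partial>half_normal \<partial>half_normal \<partial>half_normal \<partial>half_normal)"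
      by (intro nn_integral_cong Fubini') measurable
    finally show ?thesis .
  qed
  \<comment> \<open>The imaginary parts are rotated first, for fixed real parts; \<open>G\<close> is
    the function of the real parts that remains.\<close>
  define G where "G = (\<lambda>p. \<integral>\<^sup>+y. \<integral>\<^sup>+y'. f (Complex (fst p) y, Complex (snd p) y') \<partial>half_normal \<partial>half_normal)"
  have [measurable]: "G \<in> borel_measurable (borel \<Otimes>\<^sub>M borel)" unfolding G_def by measurable
  have 1: "of_real c * Complex x y + of_real s * Complex x' y' = Complex (c * x + s * x') (c * y + s * y')"
    "of_real c * Complex x' y' - of_real s * Complex x y = Complex (c * x' - s * x) (c * y' - s * y)"
    for x x' y y' by (simp_all add: complex_eq_iff)
  have "(\<integral>\<^sup>+w. \<integral>\<^sup>+z. f (of_real c * w + of_real s * z, of_real c * z - of_real s * w) \<partial>cnormal \<partial>cnormal) =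
    (\<integral>\<^sup>+x. \<integral>\<^sup>+x'. \<integral>\<^sup>+y. \<integral>\<^sup>+y'. f (Complex (c * x + s * x') (c * y + s * y'), Complex (c * x' - s * x) (c * y' - s * y))
       \<partial>half_normal \<partial>half_normal \<partial>half_normal \<partial>half_normal)"
    using unfold[of "\<lambda>p. f (of_real c * fst p + of_real s * snd p, of_real c * snd p - of_real s * fst p)"]
    by (simp add: 1)
  also have "\<dots> = (\<integral>\<^sup>+x. \<integral>\<^sup>+x'. G (c * x + s * x', c * x' - s * x) \<partial>half_normal \<partial>half_normal)"
  proof (rule nn_integral_cong, rule nn_integral_cong)
    fix x x'
    show "(\<integral>\<^sup>+y. \<integral>\<^sup>+y'. f (Complex (c * x + s * x') (c * y + s * y'), Complex (c * x' - s * x) (c * y' - s * y))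
       \<partial>half_normal \<partial>half_normal) = G (c * x + s * x', c * x' - s * x)"
      using nn_integral_half_normal_rotation[of "\<lambda>p. f (Complex (c * x + s * x') (fst p), Complex (c * x' - s * x) (snd p))", OF _ cs]
      by (simp add: G_def)
  qed
  also have "\<dots> = (\<integral>\<^sup>+x. \<integral>\<^sup>+x'. G (x, x') \<partial>half_normal \<partial>half_normal)"
    by (rule nn_integral_half_normal_rotation[OF _ cs]) measurable
  also have "\<dots> = (\<integral>\<^sup>+w. \<integral>\<^sup>+z. f (w, z) \<partial>cnormal \<partial>cnormal)"
    by (simp add: unfold G_def)
  finally show ?thesis .
qed

text \<open>Induction step of the unitary invariance: a new coordinate \<open>y\<close> is merged
  with the Gaussian \<open>w\<close> that already represents the earlier ones. A phase makes the
  coefficient of \<open>y\<close> nonnegative, and a plane rotation then turns the linear form into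
  a multiple of a single variable while preserving the sum of the two squares; \<open>S\<close>
  carries the other coordinates along.\<close>

lemma nn_integral_cnormal_combine:
  fixes \<phi> :: "complex \<times> real \<Rightarrow> ennreal"
  assumes [measurable]: "\<phi> \<in> borel_measurable (borel \<Otimes>\<^sub>M borel)" and "b \<ge> 0"
  shows "(\<integral>\<^sup>+y. \<integral>\<^sup>+w. \<phi> (a * y + of_real b * w, (cmod y)\<^sup>2 + (cmod w)\<^sup>2 + S) \<partial>cnormal \<partial>cnormal) =
    (\<integral>\<^sup>+y. \<integral>\<^sup>+w. \<phi> (of_real (sqrt ((cmod a)\<^sup>2 + b\<^sup>2)) * w, (cmod y)\<^sup>2 + (cmod w)\<^sup>2 + S) \<partial>cnormal \<partial>cnormal)"
proof (cases "(cmod a)\<^sup>2 + b\<^sup>2 = 0")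
  case True
  then have "a = 0" "b = 0" by (auto simp: sum_power2_eq_zero_iff)
  then show ?thesis by simp
next
  case False
  interpret C: prob_space cnormal by (rule prob_space_cnormal)
  define L where "L = sqrt ((cmod a)\<^sup>2 + b\<^sup>2)"
  have L: "L > 0" "L\<^sup>2 = (cmod a)\<^sup>2 + b\<^sup>2"
    using False unfolding L_def by (auto simp: less_le real_sqrt_eq_0_iff)
  \<comment> \<open>The phase of \<open>a\<close>; the value 1 at \<open>a = 0\<close> keeps
    \<open>p\<close> on the unit circle.\<close>
  define p where "p = (if a = 0 then 1 else a / of_real (cmod a))"
  have p: "cmod p = 1" "a = of_real (cmod a) * p" by (auto simp: p_def norm_divide)
  \<comment> \<open>Chosen so that \<open>L\<close> times the second rotated coordinate is
    \<open>cmod a * y + b * w\<close>; the rotation subtracts \<open>s * y\<close>, hence the minus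
    sign in \<open>s\<close>.\<close>
  define c s where "c = b / L" and "s = - cmod a / L"
  have cs: "c\<^sup>2 + s\<^sup>2 = 1"
    using L unfolding c_def s_def by (simp add: power_divide add_divide_distrib[symmetric] add.commute del: zero_less_power2)
       (use L in auto)
  define f where "f = (\<lambda>q. \<phi> (of_real L * snd q, (cmod (fst q))\<^sup>2 + (cmod (snd q))\<^sup>2 + S))"
  have [measurable]: "f \<in> borel_measurable (borel \<Otimes>\<^sub>M borel)" unfolding f_def by measurable
  have n: "(cmod (of_real c * y + of_real s * w))\<^sup>2 + (cmod (of_real c * w - of_real s * y))\<^sup>2 = (cmod y)\<^sup>2 + (cmod w)\<^sup>2"
    for y w
  proof -
    have "(cmod (of_real c * y + of_real s * w))\<^sup>2 + (cmod (of_real c * w - of_real s * y))\<^sup>2 = (c\<^sup>2 + s\<^sup>2) * ((cmod y)\<^sup>2 + (cmod w)\<^sup>2)"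
      unfolding cmod_power2 by (simp add: power2_eq_square algebra_simps)
    then show ?thesis by (simp add: cs)
  qed
  have m: "of_real L * (of_real c * w - of_real s * y) = of_real (cmod a) * y + of_real b * w" for w y :: complex
  proof -
    have "of_real L * (of_real c * w - of_real s * y) = of_real (L * c) * w - of_real (L * s) * y"
      by (simp add: algebra_simps)
    moreover have "L * c = b" "L * s = - cmod a" using L by (auto simp: c_def s_def)
    ultimately show ?thesis by simp
  qed
  have "(\<integral>\<^sup>+y. \<integral>\<^sup>+w. \<phi> (a * y + of_real b * w, (cmod y)\<^sup>2 + (cmod w)\<^sup>2 + S) \<partial>cnormal \<partial>cnormal) =
    (\<integral>\<^sup>+y. \<integral>\<^sup>+w. \<phi> (of_real (cmod a) * (p * y) + of_real b * w, (cmod (p * y))\<^sup>2 + (cmod w)\<^sup>2 + S) \<partial>cnormal \<partial>cnormal)"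
    by (subst p(2)) (simp add: p(1) norm_mult mult.assoc)
  also have "\<dots> = (\<integral>\<^sup>+y. \<integral>\<^sup>+w. \<phi> (of_real (cmod a) * y + of_real b * w, (cmod y)\<^sup>2 + (cmod w)\<^sup>2 + S) \<partial>cnormal \<partial>cnormal)"
    by (rule nn_integral_cnormal_phase[OF _ p(1), of "\<lambda>y. \<integral>\<^sup>+w. \<phi> (of_real (cmod a) * y + of_real b * w, (cmod y)\<^sup>2 + (cmod w)\<^sup>2 + S) \<partial>cnormal"]) measurable
  also have "\<dots> = (\<integral>\<^sup>+y. \<integral>\<^sup>+w. f (of_real c * y + of_real s * w, of_real c * w - of_real s * y) \<partial>cnormal \<partial>cnormal)"
    by (simp add: f_def n m)
  also have "\<dots> = (\<integral>\<^sup>+y. \<integral>\<^sup>+w. f (y, w) \<partial>cnormal \<partial>cnormal)"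
    by (rule nn_integral_cnormal_rotation[OF _ cs]) measurable
  finally show ?thesis by (simp add: f_def L_def)
qed

text \<open>The distinguished index \<open>i\<close> ends up carrying the whole linear form, and
  \<open>J\<close> only a sum of squares. The induction adds indices to \<open>J\<close> and keeps
  \<open>\<phi>\<close> arbitrary, because a fixed new coordinate shifts both arguments of
  \<open>\<phi>\<close>.\<close>

lemma nn_integral_PiM_cnormal_insert:
  fixes \<phi> :: "complex \<times> real \<Rightarrow> ennreal"
  assumes "finite J" "i \<notin> J" "\<phi> \<in> borel_measurable (borel \<Otimes>\<^sub>M borel)"
  shows "(\<integral>\<^sup>+z. \<phi> (\<Sum>j\<in>insert i J. v j * z j, \<Sum>j\<in>insert i J. (cmod (z j))\<^sup>2) \<partial>PiM (insert i J) (\<lambda>_. cnormal)) =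
    (\<integral>\<^sup>+z. \<integral>\<^sup>+w. \<phi> (of_real (L2_set (\<lambda>j. cmod (v j)) (insert i J)) * w, (cmod w)\<^sup>2 + (\<Sum>j\<in>J. (cmod (z j))\<^sup>2))
       \<partial>cnormal \<partial>PiM J (\<lambda>_. cnormal))"
  using assms
proof (induction J arbitrary: \<phi> rule: finite_induct)
  case empty
  note [measurable] = empty(2)
  interpret C: prob_space cnormal by (rule prob_space_cnormal)
  interpret P: product_prob_space "\<lambda>_. cnormal" ..
  \<comment> \<open>With a single coordinate it suffices to remove the phase of
    \<open>v i\<close>.\<close>
  have "(\<integral>\<^sup>+y. \<phi> (v i * y, (cmod y)\<^sup>2) \<partial>cnormal) = (\<integral>\<^sup>+w. \<phi> (of_real (cmod (v i)) * w, (cmod w)\<^sup>2) \<partial>cnormal)"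
  proof -
    define p where "p = (if v i = 0 then 1 else v i / of_real (cmod (v i)))"
    have p: "cmod p = 1" "v i = of_real (cmod (v i)) * p" by (auto simp: p_def norm_divide)
    have "(\<integral>\<^sup>+y. \<phi> (v i * y, (cmod y)\<^sup>2) \<partial>cnormal) = (\<integral>\<^sup>+y. \<phi> (of_real (cmod (v i)) * (p * y), (cmod (p * y))\<^sup>2) \<partial>cnormal)"
      by (subst p(2)) (simp add: p(1) norm_mult mult.assoc)
    also have "\<dots> = (\<integral>\<^sup>+w. \<phi> (of_real (cmod (v i)) * w, (cmod w)\<^sup>2) \<partial>cnormal)"
      by (rule nn_integral_cnormal_phase[OF _ p(1), of "\<lambda>y. \<phi> (of_real (cmod (v i)) * y, (cmod y)\<^sup>2)"]) measurable
    finally show ?thesis .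
  qed
  then show ?case
    by (subst P.product_nn_integral_insert) (auto simp: L2_set_def)
next
  case (insert j J)
  note [measurable] = insert.prems(2)
  interpret C: prob_space cnormal by (rule prob_space_cnormal)
  interpret P: product_prob_space "\<lambda>_. cnormal" ..
  interpret PJ: prob_space "PiM J (\<lambda>_. cnormal)" by (rule prob_space_PiM) (rule prob_space_cnormal)
  interpret pair_sigma_finite "PiM J (\<lambda>_. cnormal)" cnormal ..
  have ij: "i \<noteq> j" "i \<notin> J" "j \<notin> insert i J" using insert by auto
  let ?L = "\<lambda>A. L2_set (\<lambda>j. cmod (v j)) A" and ?S = "\<lambda>z. \<Sum>j\<in>J. (cmod (z j))\<^sup>2"
  let ?I = "insert i J"
  \<comment> \<open>The index \<open>j\<close> is split off rather than \<open>i\<close>, so that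
    \<open>insert i J\<close> of the induction hypothesis is left.\<close>
  have "(\<integral>\<^sup>+z. \<phi> (\<Sum>k\<in>insert i (insert j J). v k * z k, \<Sum>k\<in>insert i (insert j J). (cmod (z k))\<^sup>2)
      \<partial>PiM (insert i (insert j J)) (\<lambda>_. cnormal)) =
    (\<integral>\<^sup>+z. \<phi> (v j * z j + (\<Sum>k\<in>?I. v k * z k), (cmod (z j))\<^sup>2 + (\<Sum>k\<in>?I. (cmod (z k))\<^sup>2))
      \<partial>PiM (insert j ?I) (\<lambda>_. cnormal))"
    using insert.hyps ij by (simp add: insert_commute[of i j J] add_ac)
  also have "\<dots> = (\<integral>\<^sup>+y. \<integral>\<^sup>+z. \<phi> (v j * (z(j := y)) j + (\<Sum>k\<in>?I. v k * (z(j := y)) k),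
      (cmod ((z(j := y)) j))\<^sup>2 + (\<Sum>k\<in>?I. (cmod ((z(j := y)) k))\<^sup>2)) \<partial>PiM ?I (\<lambda>_. cnormal) \<partial>cnormal)"
    using insert.hyps ij by (subst P.product_nn_integral_insert_rev) auto
  also have "\<dots> = (\<integral>\<^sup>+y. \<integral>\<^sup>+z. \<phi> (v j * y + (\<Sum>k\<in>?I. v k * z k), (cmod y)\<^sup>2 + (\<Sum>k\<in>?I. (cmod (z k))\<^sup>2))
      \<partial>PiM ?I (\<lambda>_. cnormal) \<partial>cnormal)"
  proof -
    have "(\<Sum>k\<in>?I. v k * (z(j := y)) k) = (\<Sum>k\<in>?I. v k * z k)"
      "(\<Sum>k\<in>?I. (cmod ((z(j := y)) k))\<^sup>2) = (\<Sum>k\<in>?I. (cmod (z k))\<^sup>2)" for z y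
      using ij by (auto intro!: sum.cong)
    then show ?thesis by simp
  qed
  also have "\<dots> = (\<integral>\<^sup>+y. \<integral>\<^sup>+z. \<integral>\<^sup>+w. \<phi> (v j * y + of_real (?L ?I) * w, (cmod y)\<^sup>2 + ((cmod w)\<^sup>2 + ?S z))
      \<partial>cnormal \<partial>PiM J (\<lambda>_. cnormal) \<partial>cnormal)"
  proof (rule nn_integral_cong)
    fix y
    \<comment> \<open>The induction hypothesis for \<open>\<phi>\<close> shifted by the
      contributions of the fixed \<open>y\<close>.\<close>
    show "(\<integral>\<^sup>+z. \<phi> (v j * y + (\<Sum>k\<in>?I. v k * z k), (cmod y)\<^sup>2 + (\<Sum>k\<in>?I. (cmod (z k))\<^sup>2)) \<partial>PiM ?I (\<lambda>_. cnormal)) =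
      (\<integral>\<^sup>+z. \<integral>\<^sup>+w. \<phi> (v j * y + of_real (?L ?I) * w, (cmod y)\<^sup>2 + ((cmod w)\<^sup>2 + ?S z)) \<partial>cnormal \<partial>PiM J (\<lambda>_. cnormal))"
      using insert.IH[of "\<lambda>p. \<phi> (v j * y + fst p, (cmod y)\<^sup>2 + snd p)"] ij by simp
  qed
  \<comment> \<open>Fubini puts \<open>y\<close> next to \<open>w\<close>, where the two can be
    combined for fixed \<open>z\<close>.\<close>
  also have "\<dots> = (\<integral>\<^sup>+z. \<integral>\<^sup>+y. \<integral>\<^sup>+w. \<phi> (v j * y + of_real (?L ?I) * w, (cmod y)\<^sup>2 + ((cmod w)\<^sup>2 + ?S z))
      \<partial>cnormal \<partial>cnormal \<partial>PiM J (\<lambda>_. cnormal))"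
    by (rule Fubini') measurable
  also have "\<dots> = (\<integral>\<^sup>+z. \<integral>\<^sup>+y. \<integral>\<^sup>+w. \<phi> (of_real (?L (insert j ?I)) * w, (cmod y)\<^sup>2 + ((cmod w)\<^sup>2 + ?S z))
      \<partial>cnormal \<partial>cnormal \<partial>PiM J (\<lambda>_. cnormal))"
  proof (rule nn_integral_cong)
    fix z
    have "?L (insert j ?I) = sqrt ((cmod (v j))\<^sup>2 + (?L ?I)\<^sup>2)"
      using insert.hyps ij by (simp add: L2_set_def sum_nonneg)
    then show "(\<integral>\<^sup>+y. \<integral>\<^sup>+w. \<phi> (v j * y + of_real (?L ?I) * w, (cmod y)\<^sup>2 + ((cmod w)\<^sup>2 + ?S z)) \<partial>cnormal \<partial>cnormal) =
      (\<integral>\<^sup>+y. \<integral>\<^sup>+w. \<phi> (of_real (?L (insert j ?I)) * w, (cmod y)\<^sup>2 + ((cmod w)\<^sup>2 + ?S z)) \<partial>cnormal \<partial>cnormal)"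
      using nn_integral_cnormal_combine[OF insert.prems(2) L2_set_nonneg, of "v j" "\<lambda>j. cmod (v j)" ?I "?S z"]
      by (simp add: add.assoc)
  qed
  \<comment> \<open>Now \<open>y\<close> occurs only through its squared modulus and becomes
    coordinate \<open>j\<close> of the residual family.\<close>
  also have "\<dots> = (\<integral>\<^sup>+z. \<integral>\<^sup>+w. \<phi> (of_real (?L (insert j ?I)) * w, (cmod w)\<^sup>2 + (\<Sum>k\<in>insert j J. (cmod (z k))\<^sup>2))
      \<partial>cnormal \<partial>PiM (insert j J) (\<lambda>_. cnormal))"
  proof -
    have "(\<Sum>k\<in>J. (cmod ((z(j := y)) k))\<^sup>2) = ?S z" for z y
      using insert.hyps by (auto intro!: sum.cong)
    then show ?thesis
      using insert.hyps by (subst P.product_nn_integral_insert) (auto simp: add_ac)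
  qed
  finally show ?case by (simp add: insert_commute)
qed

section \<open>Tail probabilities of linear forms\<close>

text \<open>The function \<open>- exp (- x\<^sup>2) / 2\<close> is an antiderivative on the
  half-line from \<open>sqrt r\<close>; evenness of the integrand doubles the value.\<close>

lemma nn_integral_abs_exp_neg_square:
  assumes "r \<ge> 0"
  shows "(\<integral>\<^sup>+x. ennreal (\<bar>x\<bar> * exp (- x\<^sup>2)) * indicator {x. r < x\<^sup>2} x \<partial>lborel) = ennreal (exp (- r))"
proof -
  define g where "g = (\<lambda>x. ennreal (x * exp (- x\<^sup>2)) * indicator {sqrt r..} x)"
  have [measurable]: "g \<in> borel_measurable borel" unfolding g_def by measurable
  have half: "(\<integral>\<^sup>+x. g x \<partial>lborel) = ennreal (exp (- r) / 2)"
  proof -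
    have "(\<integral>\<^sup>+x. g x \<partial>lborel) = ennreal (0 - (- exp (- (sqrt r)\<^sup>2) / 2))"
      unfolding g_def
    proof (rule nn_integral_FTC_atLeast)
      show "DERIV (\<lambda>x. - exp (- x\<^sup>2) / 2) x :> x * exp (- x\<^sup>2)" for x :: real
        by (auto intro!: derivative_eq_intros)
      show "((\<lambda>x::real. - exp (- x\<^sup>2) / 2) \<longlongrightarrow> 0) at_top" by real_asymp
      show "0 \<le> x * exp (- x\<^sup>2)" if "sqrt r \<le> x" for x
        using that assms by (meson exp_ge_zero mult_nonneg_nonneg order_trans real_sqrt_ge_zero)
    qed simp
    then show ?thesis using assms by simp
  qed
  have "(\<integral>\<^sup>+x. ennreal (\<bar>x\<bar> * exp (- x\<^sup>2)) * indicator {x. r < x\<^sup>2} x \<partial>lborel) =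
    (\<integral>\<^sup>+x. g x + g (- x) \<partial>lborel)"
  proof (rule nn_integral_cong_AE)
    \<comment> \<open>The endpoints are excluded because \<open>g\<close> lives on a closed
      half-line, whereas the tail event is strict.\<close>
    have "AE x in lborel. x \<noteq> sqrt r \<and> x \<noteq> - sqrt r" by (auto intro: AE_lborel_singleton)
    then show "AE x in lborel. ennreal (\<bar>x\<bar> * exp (- x\<^sup>2)) * indicator {x. r < x\<^sup>2} x = g x + g (- x)"
    proof eventually_elim
      case (elim x)
      define s where "s = sqrt r"
      have "r < x\<^sup>2 \<longleftrightarrow> s < \<bar>x\<bar>"
        unfolding s_def by (metis real_sqrt_abs real_sqrt_less_iff)
      moreover have "s \<ge> 0" using assms by (simp add: s_def)
      ultimately show ?case using elim
        unfolding g_def s_def[symmetric] by (cases "x \<ge> 0") (auto simp: indicator_def)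
    qed
  qed
  also have "\<dots> = (\<integral>\<^sup>+x. g x \<partial>lborel) + (\<integral>\<^sup>+x. g (- x) \<partial>lborel)"
    by (rule nn_integral_add) auto
  also have "(\<integral>\<^sup>+x. g (- x) \<partial>lborel) = (\<integral>\<^sup>+x. g x \<partial>lborel)"
    using nn_integral_real_affine[of g "-1" 0] by simp
  finally show ?thesis unfolding half by (simp add: ennreal_plus[symmetric] del: ennreal_plus)
qed

text \<open>The substitution \<open>y = x s\<close> turns the Gaussian integral over \<open>r < x\<^sup>2 + y\<^sup>2\<close> into the product
  of \<open>\<integral> 1 / (1 + s\<^sup>2)\<close> and a one-dimensional integral. The former need not be evaluated: it is
  fixed by the total mass 1.\<close>

lemma cnormal_norm_square_tail:
  assumes "r \<ge> 0"
  shows "(\<integral>\<^sup>+w. indicator {w. r < (cmod w)\<^sup>2} w \<partial>cnormal) = ennreal (exp (- r))"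
proof -
  interpret C: prob_space cnormal by (rule prob_space_cnormal)
  define J where "J = (\<integral>\<^sup>+s. ennreal (1 / (pi * (1 + s\<^sup>2))) \<partial>lborel)"
  define c where "c = (\<lambda>r. \<integral>\<^sup>+x. ennreal (\<bar>x\<bar> * exp (- x\<^sup>2)) * indicator {x. r < x\<^sup>2} x \<partial>lborel)"
  have T: "(\<integral>\<^sup>+w. indicator {w. r < (cmod w)\<^sup>2} w \<partial>cnormal) = J * c r" for r
  proof -
    define F where "F = (\<lambda>q. ennreal (exp (- q) / pi) * indicator {r<..} q)"
    have [measurable]: "F \<in> borel_measurable borel" unfolding F_def by measurable
    have "(\<integral>\<^sup>+w. indicator {w. r < (cmod w)\<^sup>2} w \<partial>cnormal) = (\<integral>\<^sup>+x. \<integral>\<^sup>+y. F (x\<^sup>2 + y\<^sup>2) \<partial>lborel \<partial>lborel)"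
      using nn_integral_half_normal2[of "\<lambda>p. indicator {r<..} ((fst p)\<^sup>2 + (snd p)\<^sup>2)"]
      by (subst nn_integral_cnormal) (auto simp: F_def cmod_power2 indicator_def)
    also have "\<dots> = (\<integral>\<^sup>+x. \<integral>\<^sup>+s. ennreal \<bar>x\<bar> * F (x\<^sup>2 * (1 + s\<^sup>2)) \<partial>lborel \<partial>lborel)"
    proof (rule nn_integral_cong_AE)
      \<comment> \<open>At \<open>x = 0\<close> the substitution \<open>y = x * s\<close>
        degenerates.\<close>
      have "AE x in lborel. x \<noteq> (0::real)" by (rule AE_lborel_singleton)
      then show "AE x in lborel. (\<integral>\<^sup>+y. F (x\<^sup>2 + y\<^sup>2) \<partial>lborel) = (\<integral>\<^sup>+s. ennreal \<bar>x\<bar> * F (x\<^sup>2 * (1 + s\<^sup>2)) \<partial>lborel)"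
      proof eventually_elim
        case (elim x)
        then have "(\<integral>\<^sup>+y. F (x\<^sup>2 + y\<^sup>2) \<partial>lborel) = ennreal \<bar>x\<bar> * (\<integral>\<^sup>+s. F (x\<^sup>2 + (0 + x * s)\<^sup>2) \<partial>lborel)"
          by (intro nn_integral_real_affine) auto
        then show ?case by (simp add: nn_integral_cmult power_mult_distrib algebra_simps)
      qed
    qed
    also have "\<dots> = (\<integral>\<^sup>+s. \<integral>\<^sup>+x. ennreal \<bar>x\<bar> * F (x\<^sup>2 * (1 + s\<^sup>2)) \<partial>lborel \<partial>lborel)"
      by (rule lborel_pair.Fubini') measurable
    also have "\<dots> = (\<integral>\<^sup>+s. ennreal (1 / (pi * (1 + s\<^sup>2))) * c r \<partial>lborel)"
    proof (rule nn_integral_cong)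
      fix s :: real
      \<comment> \<open>Scaling by \<open>a\<close> turns \<open>x\<^sup>2 * (1 + s\<^sup>2)\<close>
        into \<open>x\<^sup>2\<close>; the Jacobian and the weight \<open>\<bar>x\<bar>\<close> each
        give a factor \<open>a\<close>, together \<open>1 / (1 + s\<^sup>2)\<close>.\<close>
      define a where "a = 1 / sqrt (1 + s\<^sup>2)"
      have pos: "0 < 1 + s\<^sup>2" by (simp add: add_pos_nonneg)
      then have a: "a > 0" "a\<^sup>2 = 1 / (1 + s\<^sup>2)" by (auto simp: a_def power_divide)
      have "(\<integral>\<^sup>+x. ennreal \<bar>x\<bar> * F (x\<^sup>2 * (1 + s\<^sup>2)) \<partial>lborel) =
        ennreal \<bar>a\<bar> * (\<integral>\<^sup>+x. ennreal \<bar>0 + a * x\<bar> * F ((0 + a * x)\<^sup>2 * (1 + s\<^sup>2)) \<partial>lborel)"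
        using a by (intro nn_integral_real_affine) auto
      also have "\<dots> = (\<integral>\<^sup>+x. ennreal a * (ennreal (a * \<bar>x\<bar>) * F (x\<^sup>2)) \<partial>lborel)"
        using a pos by (simp add: nn_integral_cmult abs_mult power_mult_distrib)
      also have "\<dots> = (\<integral>\<^sup>+x. ennreal (1 / (pi * (1 + s\<^sup>2))) * (ennreal (\<bar>x\<bar> * exp (- x\<^sup>2)) * indicator {x. r < x\<^sup>2} x) \<partial>lborel)"
      proof (rule nn_integral_cong)
        fix x
        have "a * (a * \<bar>x\<bar> * (exp (- x\<^sup>2) / pi)) = a\<^sup>2 * (\<bar>x\<bar> * (exp (- x\<^sup>2) / pi))"
          by (simp add: power2_eq_square mult_ac)
        also have "\<dots> = 1 / (pi * (1 + s\<^sup>2)) * (\<bar>x\<bar> * exp (- x\<^sup>2))" by (simp add: a mult_ac)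
        finally have "ennreal a * (ennreal (a * \<bar>x\<bar>) * ennreal (exp (- x\<^sup>2) / pi)) =
          ennreal (1 / (pi * (1 + s\<^sup>2))) * ennreal (\<bar>x\<bar> * exp (- x\<^sup>2))"
          using a pos by (simp add: ennreal_mult[symmetric])
        then show "ennreal a * (ennreal (a * \<bar>x\<bar>) * F (x\<^sup>2)) =
          ennreal (1 / (pi * (1 + s\<^sup>2))) * (ennreal (\<bar>x\<bar> * exp (- x\<^sup>2)) * indicator {x. r < x\<^sup>2} x)"
          by (simp add: F_def indicator_def)
      qed
      also have "\<dots> = ennreal (1 / (pi * (1 + s\<^sup>2))) * c r"
        unfolding c_def by (rule nn_integral_cmult) measurable
      finally show "(\<integral>\<^sup>+x. ennreal \<bar>x\<bar> * F (x\<^sup>2 * (1 + s\<^sup>2)) \<partial>lborel) = ennreal (1 / (pi * (1 + s\<^sup>2))) * c r" .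
    qed
    also have "\<dots> = J * c r"
      unfolding J_def by (rule nn_integral_multc) measurable
    finally show ?thesis .
  qed
  \<comment> \<open>With threshold -1 the event is the whole space, \<open>w = 0\<close> included,
    so the total mass gives \<open>J * c (-1) = 1\<close>. Passing from threshold 0 to -1 adds only
    the point \<open>x = 0\<close>, where the weight \<open>\<bar>x\<bar>\<close> vanishes.\<close>
  have "c (-1) = c 0"
    unfolding c_def by (intro nn_integral_cong) (auto simp: indicator_def intro: less_le_trans[of _ 0])
  also have "c 0 = 1" using nn_integral_abs_exp_neg_square[of 0] by (simp add: c_def)
  finally have "J = (\<integral>\<^sup>+w. indicator {w. - 1 < (cmod w)\<^sup>2} w \<partial>cnormal)" by (simp add: T)
  also have "{w. - 1 < (cmod w)\<^sup>2} = space cnormal" by (auto intro: less_le_trans[of _ 0])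
  finally have "J = 1" using C.emeasure_space_1 by simp
  then show ?thesis using T[of r] nn_integral_abs_exp_neg_square[OF assms] by (simp add: c_def)
qed

text \<open>The Laplace transform of the exponential law. In each real coordinate the scaling by
  \<open>a = 1 / sqrt (1 + c)\<close> restores the half-normal density, whose mass is 1; the two
  coordinates give \<open>a * a\<close>.\<close>

lemma nn_integral_cnormal_exp:
  assumes "c \<ge> 0"
  shows "(\<integral>\<^sup>+w. ennreal (exp (- (c * (cmod w)\<^sup>2))) \<partial>cnormal) = ennreal (1 / (1 + c))"
proof -
  interpret H: prob_space half_normal by (rule prob_space_half_normal)
  define a where "a = 1 / sqrt (1 + c)"
  have a: "a > 0" "a * a = 1 / (1 + c)" "a\<^sup>2 = 1 / (1 + c)"
    using assms by (auto simp: a_def power_divide)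
  have *: "(\<integral>\<^sup>+x. ennreal (exp (- (c * x\<^sup>2))) \<partial>half_normal) = ennreal a"
  proof -
    have "(\<integral>\<^sup>+x. ennreal (exp (- (c * x\<^sup>2))) \<partial>half_normal) = (\<integral>\<^sup>+x. ennreal (exp (- (1 + c) * x\<^sup>2) / sqrt pi) \<partial>lborel)"
      by (simp add: nn_integral_density normal_density_half ennreal_mult[symmetric] algebra_simps exp_add[symmetric])
    also have "\<dots> = ennreal \<bar>a\<bar> * (\<integral>\<^sup>+x. ennreal (exp (- (1 + c) * (0 + a * x)\<^sup>2) / sqrt pi) \<partial>lborel)"
      using a by (intro nn_integral_real_affine) auto
    also have "(\<lambda>x. - (1 + c) * (0 + a * x)\<^sup>2) = (\<lambda>x. - x\<^sup>2)"
    proof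
      fix x
      have "- (1 + c) * (0 + a * x)\<^sup>2 = - ((1 + c) * a\<^sup>2) * x\<^sup>2" by (simp add: power_mult_distrib algebra_simps)
      also have "(1 + c) * a\<^sup>2 = 1" using a assms by simp
      finally show "- (1 + c) * (0 + a * x)\<^sup>2 = - x\<^sup>2" by simp
    qed
    also have "(\<integral>\<^sup>+x. ennreal (exp (- x\<^sup>2) / sqrt pi) \<partial>lborel) = 1"
      using H.emeasure_space_1 by (simp add: emeasure_density normal_density_half)
    finally show ?thesis using a by simp
  qed
  have "(\<integral>\<^sup>+w. ennreal (exp (- (c * (cmod w)\<^sup>2))) \<partial>cnormal) =
     (\<integral>\<^sup>+x. \<integral>\<^sup>+y. ennreal (exp (- (c * x\<^sup>2))) * ennreal (exp (- (c * y\<^sup>2))) \<partial>half_normal \<partial>half_normal)"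
    by (subst nn_integral_cnormal) (simp_all add: cmod_power2 ennreal_mult[symmetric] exp_add[symmetric] algebra_simps)
  also have "\<dots> = ennreal a * ennreal a"
    by (simp add: nn_integral_cmult nn_integral_multc *)
  finally show ?thesis using a by (simp add: ennreal_mult[symmetric])
qed

text \<open>The linear form has the law of its coefficient norm times one standard Gaussian. The
  test function ignores the sum of squares, so the residual coordinates integrate to 1.\<close>

lemma PiM_cnormal_linear_tail:
  assumes "finite I" and L: "L2_set (\<lambda>j. cmod (v j)) I > 0" and q: "q \<ge> 0"
  shows "(\<integral>\<^sup>+z. indicator {q<..} ((cmod (\<Sum>j\<in>I. v j * z j))\<^sup>2) \<partial>PiM I (\<lambda>_. cnormal)) =
    ennreal (exp (- (q / (L2_set (\<lambda>j. cmod (v j)) I)\<^sup>2)))"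
proof -
  have "I \<noteq> {}" using L by auto
  then obtain i J where I: "I = insert i J" "i \<notin> J" by (meson Set.set_insert ex_in_conv)
  then have J: "finite J" using assms by simp
  define L where "L = L2_set (\<lambda>j. cmod (v j)) I"
  have L: "L > 0" using assms by (simp add: L_def)
  interpret C: prob_space cnormal by (rule prob_space_cnormal)
  interpret PJ: prob_space "PiM J (\<lambda>_. cnormal)" by (rule prob_space_PiM) (rule prob_space_cnormal)
  have "(\<integral>\<^sup>+z. indicator {q<..} ((cmod (\<Sum>j\<in>I. v j * z j))\<^sup>2) \<partial>PiM I (\<lambda>_. cnormal)) =
    (\<integral>\<^sup>+z. \<integral>\<^sup>+w. indicator {q<..} ((cmod (of_real L * w))\<^sup>2) \<partial>cnormal \<partial>PiM J (\<lambda>_. cnormal))"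
    using nn_integral_PiM_cnormal_insert[OF J I(2), of "\<lambda>p. indicator {q<..} ((cmod (fst p))\<^sup>2)" v]
    by (simp add: I(1)[symmetric] L_def)
  also have "(\<lambda>w. indicator {q<..} ((cmod (of_real L * w))\<^sup>2) :: ennreal) = indicator {w. q / L\<^sup>2 < (cmod w)\<^sup>2}"
    using L by (auto simp: fun_eq_iff indicator_def norm_mult power_mult_distrib field_simps)
  also have "(\<integral>\<^sup>+z. \<integral>\<^sup>+w. indicator {w. q / L\<^sup>2 < (cmod w)\<^sup>2} w \<partial>cnormal \<partial>PiM J (\<lambda>_. cnormal)) = ennreal (exp (- (q / L\<^sup>2)))"
    using q L cnormal_norm_square_tail[of "q / L\<^sup>2"] by (simp add: PJ.emeasure_space_1)
  finally show ?thesis by (simp add: L_def)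
qed

text \<open>Given the residual sum of squares, the tail is an exponential, which factors over the
  \<open>card I - 1\<close> residual coordinates. The ratio is compared in cleared form, as a
  difference, so nothing is divided by a sum of squares that may vanish.\<close>

lemma PiM_cnormal_ratio_tail:
  assumes "finite I" and L: "L2_set (\<lambda>j. cmod (v j)) I > 0" and x: "0 < x" "x < 1"
  shows "(\<integral>\<^sup>+z. indicator {0<..} ((cmod (\<Sum>j\<in>I. v j * z j))\<^sup>2 -
        x * (L2_set (\<lambda>j. cmod (v j)) I)\<^sup>2 * (\<Sum>j\<in>I. (cmod (z j))\<^sup>2)) \<partial>PiM I (\<lambda>_. cnormal)) =
    ennreal ((1 - x) ^ (card I - 1))"
proof -
  have "I \<noteq> {}" using L by auto
  then obtain i J where I: "I = insert i J" "i \<notin> J" by (meson Set.set_insert ex_in_conv)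
  then have J: "finite J" "card I - 1 = card J" using assms by auto
  define L where "L = L2_set (\<lambda>j. cmod (v j)) I"
  have L: "L > 0" using assms by (simp add: L_def)
  \<comment> \<open>Solving \<open>(1 - x) * (cmod w)\<^sup>2 > x * S\<close> for
    \<open>(cmod w)\<^sup>2\<close> gives this factor of the residual sum \<open>S\<close>.\<close>
  define c where "c = x / (1 - x)"
  have c: "c \<ge> 0" "1 / (1 + c) = 1 - x" using x by (auto simp: c_def field_simps)
  interpret C: prob_space cnormal by (rule prob_space_cnormal)
  interpret P: product_prob_space "\<lambda>_. cnormal" ..
  let ?S = "\<lambda>z. \<Sum>j\<in>J. (cmod (z j))\<^sup>2"
  have "(\<integral>\<^sup>+z. indicator {0<..} ((cmod (\<Sum>j\<in>I. v j * z j))\<^sup>2 - x * L\<^sup>2 * (\<Sum>j\<in>I. (cmod (z j))\<^sup>2)) \<partial>PiM I (\<lambda>_. cnormal)) =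
    (\<integral>\<^sup>+z. \<integral>\<^sup>+w. indicator {0<..} ((cmod (of_real L * w))\<^sup>2 - x * L\<^sup>2 * ((cmod w)\<^sup>2 + ?S z)) \<partial>cnormal \<partial>PiM J (\<lambda>_. cnormal))"
    using nn_integral_PiM_cnormal_insert[OF J(1) I(2), of "\<lambda>p. indicator {0<..} ((cmod (fst p))\<^sup>2 - x * L\<^sup>2 * snd p)" v]
    by (simp add: I(1)[symmetric] L_def)
  also have "\<dots> = (\<integral>\<^sup>+z. (\<Prod>j\<in>J. ennreal (exp (- (c * (cmod (z j))\<^sup>2)))) \<partial>PiM J (\<lambda>_. cnormal))"
  proof (rule nn_integral_cong)
    fix z
    have "0 < (cmod (of_real L * w))\<^sup>2 - x * L\<^sup>2 * ((cmod w)\<^sup>2 + ?S z) \<longleftrightarrow> c * ?S z < (cmod w)\<^sup>2" for w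
    proof -
      have "(cmod (of_real L * w))\<^sup>2 - x * L\<^sup>2 * ((cmod w)\<^sup>2 + ?S z) = L\<^sup>2 * ((1 - x) * (cmod w)\<^sup>2 - x * ?S z)"
        by (simp add: norm_mult power_mult_distrib algebra_simps)
      also have "0 < \<dots> \<longleftrightarrow> 0 < (1 - x) * (cmod w)\<^sup>2 - x * ?S z"
        using L by (simp add: zero_less_mult_iff)
      also have "\<dots> \<longleftrightarrow> c * ?S z < (cmod w)\<^sup>2" using x by (simp add: c_def field_simps)
      finally show ?thesis .
    qed
    then have "(\<lambda>w. indicator {0<..} ((cmod (of_real L * w))\<^sup>2 - x * L\<^sup>2 * ((cmod w)\<^sup>2 + ?S z)) :: ennreal) =
      indicator {w. c * ?S z < (cmod w)\<^sup>2}"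
      by (auto simp: indicator_def fun_eq_iff)
    then have "(\<integral>\<^sup>+w. indicator {0<..} ((cmod (of_real L * w))\<^sup>2 - x * L\<^sup>2 * ((cmod w)\<^sup>2 + ?S z)) \<partial>cnormal) = ennreal (exp (- (c * ?S z)))"
      using c cnormal_norm_square_tail[of "c * ?S z"] by (simp add: sum_nonneg)
    also have "\<dots> = (\<Prod>j\<in>J. ennreal (exp (- (c * (cmod (z j))\<^sup>2))))"
      using J by (simp add: prod_ennreal exp_sum[symmetric] sum_distrib_left sum_negf)
    finally show "(\<integral>\<^sup>+w. indicator {0<..} ((cmod (of_real L * w))\<^sup>2 - x * L\<^sup>2 * ((cmod w)\<^sup>2 + ?S z)) \<partial>cnormal) =
      (\<Prod>j\<in>J. ennreal (exp (- (c * (cmod (z j))\<^sup>2))))" .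
  qed
  also have "\<dots> = (\<Prod>j\<in>J. \<integral>\<^sup>+w. ennreal (exp (- (c * (cmod w)\<^sup>2))) \<partial>cnormal)"
    using J by (intro P.product_nn_integral_prod) auto
  also have "\<dots> = ennreal ((1 - x) ^ (card I - 1))"
    using x by (simp only: nn_integral_cnormal_exp[OF c(1)] c(2) J(2) prod_constant) (simp add: ennreal_power)
  finally show ?thesis by (simp add: L_def)
qed

section \<open>The receive beamformer\<close>

lemma cscalar_prod_sum:
  assumes "w \<in> carrier_vec n"
  shows "v \<bullet>c w = (\<Sum>i<n. v $ i * cnj (w $ i))"
  using assms by (auto simp: scalar_prod_def atLeast0LessThan)

lemma l2norm_square: "v \<in> carrier_vec n \<Longrightarrow> (l2norm v)\<^sup>2 = (\<Sum>i<n. (cmod (v $ i))\<^sup>2)"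
  by (auto simp: l2norm_def L2_set_def sum_nonneg)

lemma cscalar_prod_self: "v \<bullet>c v = complex_of_real ((l2norm v)\<^sup>2)" for v :: "complex vec"
  by (simp add: cscalar_prod_sum[OF carrier_vec_dim_vec] l2norm_square[OF carrier_vec_dim_vec] complex_norm_square
      del: of_real_power)

lemma l2norm_eq_0_iff: "v \<in> carrier_vec n \<Longrightarrow> l2norm v = 0 \<longleftrightarrow> v = 0\<^sub>v n"
  by (auto simp: l2norm_def L2_set_eq_0_iff)

lemma l2norm_nonneg: "l2norm v \<ge> 0"
  by (simp add: l2norm_def)

lemma cscalar_prod_swap:
  assumes "v \<in> carrier_vec n" "w \<in> carrier_vec n"
  shows "cnj (v \<bullet>c w) = w \<bullet>c v"
  using assms by (simp add: cscalar_prod_sum mult.commute)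

lemma mult_mat_vec_index_sum:
  assumes "A \<in> carrier_mat m n" "v \<in> carrier_vec n" "i < m"
  shows "(A *\<^sub>v v) $ i = (\<Sum>j<n. A $$ (i, j) * v $ j)"
  using assms by (auto simp: scalar_prod_def atLeast0LessThan)

lemma mult_mat_vec_zero: "A \<in> carrier_mat m n \<Longrightarrow> A *\<^sub>v 0\<^sub>v n = 0\<^sub>v m"
  by (intro eq_vecI) auto

lemma mat_adjoint_carrier: "A \<in> carrier_mat m n \<Longrightarrow> mat_adjoint A \<in> carrier_mat n m"
  unfolding mat_adjoint_def by auto

lemma mat_adjoint_index:
  fixes A :: "complex mat"
  shows "A \<in> carrier_mat m n \<Longrightarrow> i < n \<Longrightarrow> j < m \<Longrightarrow> mat_adjoint A $$ (i, j) = cnj (A $$ (j, i))"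
  unfolding mat_adjoint_def by (auto simp: mat_of_rows_index)

lemma mat_adjoint_cscalar_prod:
  fixes A :: "complex mat"
  assumes A: "A \<in> carrier_mat m n" and v: "v \<in> carrier_vec m" and u: "u \<in> carrier_vec n"
  shows "(mat_adjoint A *\<^sub>v v) \<bullet>c u = v \<bullet>c (A *\<^sub>v u)"
proof -
  have Au: "A *\<^sub>v u \<in> carrier_vec m" using assms by auto
  have "(mat_adjoint A *\<^sub>v v) \<bullet>c u = (\<Sum>i<n. \<Sum>j<m. cnj (A $$ (j, i)) * v $ j * cnj (u $ i))"
    using assms
    by (simp add: cscalar_prod_sum[OF u] mult_mat_vec_index_sum[OF mat_adjoint_carrier[OF A] v]
        mat_adjoint_index[OF A] sum_distrib_right)
  also have "\<dots> = (\<Sum>j<m. \<Sum>i<n. cnj (A $$ (j, i)) * v $ j * cnj (u $ i))"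
    by (rule sum.swap)
  also have "\<dots> = v \<bullet>c (A *\<^sub>v u)"
    by (simp add: cscalar_prod_sum[OF Au] mult_mat_vec_index_sum[OF A u] sum_distrib_left mult_ac
        del: index_mult_mat_vec)
  finally show ?thesis .
qed

lemma outer_carrier: "v \<in> carrier_vec n \<Longrightarrow> outer v \<in> carrier_mat n n"
  by (auto simp: outer_def)

lemma outer_mult_vec:
  assumes "v \<in> carrier_vec n" "w \<in> carrier_vec n"
  shows "outer v *\<^sub>v w = (w \<bullet>c v) \<cdot>\<^sub>v v"
proof (rule eq_vecI)
  fix i assume i: "i < dim_vec ((w \<bullet>c v) \<cdot>\<^sub>v v)"
  then have "(outer v *\<^sub>v w) $ i = (\<Sum>j<n. outer v $$ (i, j) * w $ j)"
    using assms by (intro mult_mat_vec_index_sum) (auto simp: outer_def)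
  also have "\<dots> = ((w \<bullet>c v) \<cdot>\<^sub>v v) $ i"
    using i assms by (simp add: outer_def cscalar_prod_sum sum_distrib_left mult_ac)
  finally show "(outer v *\<^sub>v w) $ i = ((w \<bullet>c v) \<cdot>\<^sub>v v) $ i" .
qed (use assms in \<open>auto simp: outer_def\<close>)

lemma smult_cscalar_prod:
  assumes "v \<in> carrier_vec n" "w \<in> carrier_vec n"
  shows "(c \<cdot>\<^sub>v v) \<bullet>c w = c * (v \<bullet>c w)"
  using assms by (simp add: smult_scalar_prod_distrib[of _ n])

lemma quad_form_smult:
  assumes "B \<in> carrier_mat n n" "t \<in> carrier_vec n"
  shows "quad_form (c \<cdot>\<^sub>m B) t = c * quad_form B t"
proof -
  have "(c \<cdot>\<^sub>m B) *\<^sub>v t = c \<cdot>\<^sub>v (B *\<^sub>v t)"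
    using assms by (intro eq_vecI) auto
  then show ?thesis using assms unfolding quad_form_def
    by (simp add: smult_cscalar_prod[of _ n])
qed

text \<open>The adjoint moves to the other side of the inner product; both \<open>A_mat\<close> and
  \<open>Q1\<close> have this shape.\<close>

lemma quad_form_congruence:
  assumes "A \<in> carrier_mat m n" "B \<in> carrier_mat m m" "t \<in> carrier_vec n"
  shows "quad_form (mat_adjoint A * B * A) t = quad_form B (A *\<^sub>v t)"
proof -
  have A': "mat_adjoint A \<in> carrier_mat n m" using assms by (simp add: mat_adjoint_carrier)
  then have "((mat_adjoint A * B) * A) *\<^sub>v t = mat_adjoint A *\<^sub>v (B *\<^sub>v (A *\<^sub>v t))"
    using assms by (simp add: assoc_mult_mat_vec[of "mat_adjoint A * B" n m A n] assoc_mult_mat_vec[of "mat_adjoint A" n m B m]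
        del: assoc_mult_mat)
  then show ?thesis
    using assms unfolding quad_form_def by (simp add: mat_adjoint_cscalar_prod[of _ m n])
qed

text \<open>With a rank-one middle factor the form is an inner product times its conjugate, hence a
  squared modulus.\<close>

lemma quad_form_Q1:
  assumes "H k \<in> carrier_mat m n" "r k \<in> carrier_vec m" "t \<in> carrier_vec n"
  shows "quad_form (Q1 a \<epsilon> H r k) t = of_real (a k / \<epsilon> k * (cmod ((H k *\<^sub>v t) \<bullet>c r k))\<^sup>2)"
proof -
  have Ht: "H k *\<^sub>v t \<in> carrier_vec m" using assms by auto
  have "mat_adjoint (H k) * outer (r k) * H k \<in> carrier_mat n n"
    using assms mat_adjoint_carrier[of "H k" m n] outer_carrier[of "r k" m] by auto
  then have "quad_form (Q1 a \<epsilon> H r k) t = of_real (a k / \<epsilon> k) * quad_form (outer (r k)) (H k *\<^sub>v t)"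
    unfolding Q1_def using assms outer_carrier[of "r k" m]
    by (simp only: quad_form_smult quad_form_congruence)
  also have "quad_form (outer (r k)) (H k *\<^sub>v t) =
      ((H k *\<^sub>v t) \<bullet>c r k) * cnj ((H k *\<^sub>v t) \<bullet>c r k)"
    unfolding quad_form_def using assms Ht
    by (simp only: outer_mult_vec[OF assms(2) Ht] smult_cscalar_prod[OF assms(2) Ht] cscalar_prod_swap[OF Ht assms(2)])
  also have "\<dots> = of_real ((cmod ((H k *\<^sub>v t) \<bullet>c r k))\<^sup>2)"
    by (simp add: complex_norm_square del: of_real_power)
  finally show ?thesis by simp
qed

lemma quad_form_Q2:
  assumes "H k \<in> carrier_mat m n" "t \<in> carrier_vec n"
  shows "quad_form (Q2 N a \<epsilon> \<delta> H k) t =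
    of_real ((1 - \<delta> k powr (1 / (real (N k) - 1))) / \<epsilon> k * a k * (l2norm (H k *\<^sub>v t))\<^sup>2)"
proof -
  have H: "mat_adjoint (H k) \<in> carrier_mat n m" using assms by (simp add: mat_adjoint_carrier)
  have Ht: "H k *\<^sub>v t \<in> carrier_vec m" using assms by auto
  have "quad_form (mat_adjoint (H k) * H k) t = (H k *\<^sub>v t) \<bullet>c (H k *\<^sub>v t)"
    unfolding quad_form_def assoc_mult_mat_vec[OF H assms]
    by (rule mat_adjoint_cscalar_prod[OF assms(1) Ht assms(2)])
  moreover have "mat_adjoint (H k) * H k \<in> carrier_mat n n" using H assms by auto
  ultimately show ?thesis unfolding Q2_def
    by (simp add: quad_form_smult[OF _ assms(2)] cscalar_prod_self)
qed

lemma quad_form_Q3: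
  assumes "t \<in> carrier_vec n"
  shows "quad_form (Q3 n a \<epsilon> \<delta> k) t = of_real (a k / \<epsilon> k * ln (1 / \<delta> k) * (l2norm t)\<^sup>2)"
  unfolding Q3_def quad_form_smult[OF one_carrier_mat assms]
  using assms by (simp add: quad_form_def cscalar_prod_self)

section \<open>The positive definite form of \<Phi>\<close>

lemma Phi_mat_carrier: "Phi_mat n K a N0 h \<in> carrier_mat n n"
  by (simp add: Phi_mat_def)

text \<open>The sesquilinear form \<open>u\<^sup>H \<Phi> w\<close>, linear in \<open>w\<close>,
  written without matrix entries so that Cauchy--Schwarz can be applied to its summands.\<close>

definition Phi_form ::
  "nat \<Rightarrow> (nat \<Rightarrow> real) \<Rightarrow> real \<Rightarrow> (nat \<Rightarrow> complex vec) \<Rightarrow> complex vec \<Rightarrow> complex vec \<Rightarrow> complex" where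
  "Phi_form K a N0 h w u = (\<Sum>k = 1..K. of_real (a k) * (w \<bullet>c h k) * cnj (u \<bullet>c h k)) + of_real N0 * (w \<bullet>c u)"

lemma Phi_mat_mult_cscalar_prod:
  assumes h: "\<forall>k\<in>{1..K}. h k \<in> carrier_vec n" and w: "w \<in> carrier_vec n" and u: "u \<in> carrier_vec n"
  shows "(Phi_mat n K a N0 h *\<^sub>v w) \<bullet>c u = Phi_form K a N0 h w u"
proof -
  have idx: "Phi_mat n K a N0 h $$ (i, j) =
      (\<Sum>k = 1..K. of_real (a k) * h k $ i * cnj (h k $ j)) + (if i = j then of_real N0 else 0)"
    if "i < n" "j < n" for i j
    using that h by (auto simp: Phi_mat_def outer_def mult.assoc intro!: sum.cong)
  have "(Phi_mat n K a N0 h *\<^sub>v w) \<bullet>c u =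
     (\<Sum>i<n. (\<Sum>j<n. Phi_mat n K a N0 h $$ (i, j) * w $ j) * cnj (u $ i))"
    by (simp add: cscalar_prod_sum[OF u] mult_mat_vec_index_sum[OF Phi_mat_carrier w] del: index_mult_mat_vec)
  also have "\<dots> = (\<Sum>i<n. \<Sum>j<n. \<Sum>k = 1..K. of_real (a k) * h k $ i * cnj (h k $ j) * w $ j * cnj (u $ i)) +
      (\<Sum>i<n. \<Sum>j<n. (if i = j then of_real N0 else 0) * w $ j * cnj (u $ i))"
    by (simp add: idx distrib_right sum.distrib sum_distrib_right)
  also have "(\<Sum>i<n. \<Sum>j<n. (if i = j then of_real N0 else 0) * w $ j * cnj (u $ i)) = of_real N0 * (w \<bullet>c u)"
    by (simp add: cscalar_prod_sum[OF u] if_distrib if_distribR sum_distrib_left mult.assoc cong: if_cong)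
  also have "(\<Sum>i<n. \<Sum>j<n. \<Sum>k = 1..K. of_real (a k) * h k $ i * cnj (h k $ j) * w $ j * cnj (u $ i)) =
     (\<Sum>i<n. \<Sum>k = 1..K. \<Sum>j<n. of_real (a k) * h k $ i * cnj (h k $ j) * w $ j * cnj (u $ i))"
    by (intro sum.cong refl sum.swap)
  also have "\<dots> = (\<Sum>k = 1..K. \<Sum>i<n. \<Sum>j<n. of_real (a k) * h k $ i * cnj (h k $ j) * w $ j * cnj (u $ i))"
    by (rule sum.swap)
  also have "\<dots> = (\<Sum>k = 1..K. of_real (a k) * (w \<bullet>c h k) * cnj (u \<bullet>c h k))"
  proof (rule sum.cong)
    fix k assume "k \<in> {1..K}"
    then have hk: "h k \<in> carrier_vec n" using h by auto
    show "(\<Sum>i<n. \<Sum>j<n. of_real (a k) * h k $ i * cnj (h k $ j) * w $ j * cnj (u $ i)) =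
      of_real (a k) * (w \<bullet>c h k) * cnj (u \<bullet>c h k)"
      unfolding cscalar_prod_sum[OF hk] cnj_sum
      by (subst sum.swap) (simp add: sum_distrib_left sum_distrib_right mult_ac)
  qed simp
  finally show ?thesis unfolding Phi_form_def .
qed

text \<open>Triangle inequality and real Cauchy--Schwarz; the index set is left general because a
  disjoint union is used for \<Phi>.\<close>

lemma cmod_sum_product_le:
  "cmod (\<Sum>i\<in>I. f i * cnj (g i)) \<le> L2_set (\<lambda>i. cmod (f i)) I * L2_set (\<lambda>i. cmod (g i)) I"
proof -
  have "cmod (\<Sum>i\<in>I. f i * cnj (g i)) \<le> (\<Sum>i\<in>I. \<bar>cmod (f i)\<bar> * \<bar>cmod (g i)\<bar>)"
    by (rule order_trans[OF norm_sum]) (simp add: norm_mult)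
  also have "\<dots> \<le> L2_set (\<lambda>i. cmod (f i)) I * L2_set (\<lambda>i. cmod (g i)) I"
    by (rule L2_set_mult_ineq)
  finally show ?thesis .
qed

text \<open>The quadratic form of \<Phi>. The factor \<open>(l2norm u)\<^sup>2\<close> makes the
  SINR denominator homogeneous; on the unit sphere the two agree.\<close>

definition interference_power ::
  "nat \<Rightarrow> (nat \<Rightarrow> real) \<Rightarrow> real \<Rightarrow> (nat \<Rightarrow> complex vec) \<Rightarrow> complex vec \<Rightarrow> real" where
  "interference_power K a N0 h u = (\<Sum>k = 1..K. a k * (cmod (u \<bullet>c h k))\<^sup>2) + N0 * (l2norm u)\<^sup>2"

lemma Phi_form_self: "Phi_form K a N0 h u u = of_real (interference_power K a N0 h u)"
  by (simp add: Phi_form_def interference_power_def cscalar_prod_self mult.assoc complex_norm_square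
      del: of_real_power)

text \<open>The form is the standard inner product of longer vectors, in which the weighted
  projections on the \<open>h k\<close> are stacked on the weighted coordinates.\<close>

lemma Phi_form_Cauchy_Schwarz:
  assumes a: "\<forall>k\<in>{1..K}. a k \<ge> 0" and "N0 \<ge> 0" and w: "w \<in> carrier_vec n" and u: "u \<in> carrier_vec n"
  shows "(cmod (Phi_form K a N0 h w u))\<^sup>2 \<le> interference_power K a N0 h w * interference_power K a N0 h u"
proof -
  \<comment> \<open>The stacked vector: \<open>Inl\<close> indexes the interferers,
    \<open>Inr\<close> the coordinates; square roots of the weights go to both factors of each
    product.\<close>
  define p where "p = (\<lambda>v i. case i of Inl k \<Rightarrow> of_real (sqrt (a k)) * (v \<bullet>c h k)
    | Inr j \<Rightarrow> of_real (sqrt N0) * v $ j)"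
  let ?I = "{1..K} <+> {..<n}"
  have s: "complex_of_real (sqrt (a k)) * complex_of_real (sqrt (a k)) = of_real (a k)" if "k \<in> {1..K}" for k
    using that a by (simp add: of_real_mult[symmetric] del: of_real_mult)
  have s': "complex_of_real (sqrt N0) * complex_of_real (sqrt N0) = of_real N0"
    using assms(2) by (simp add: of_real_mult[symmetric] del: of_real_mult)
  have 1: "Phi_form K a N0 h w u = (\<Sum>i\<in>?I. p w i * cnj (p u i))"
  proof -
    have "(\<Sum>k = 1..K. of_real (a k) * (w \<bullet>c h k) * cnj (u \<bullet>c h k)) = (\<Sum>k = 1..K. p w (Inl k) * cnj (p u (Inl k)))"
    proof (rule sum.cong)
      fix k assume "k \<in> {1..K}"
      show "of_real (a k) * (w \<bullet>c h k) * cnj (u \<bullet>c h k) = p w (Inl k) * cnj (p u (Inl k))"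
        unfolding s[OF \<open>k \<in> {1..K}\<close>, symmetric] by (simp add: p_def mult_ac)
    qed simp
    moreover have "of_real N0 * (w \<bullet>c u) = (\<Sum>j<n. p w (Inr j) * cnj (p u (Inr j)))"
      unfolding s'[symmetric] cscalar_prod_sum[OF u] by (simp add: p_def sum_distrib_left mult_ac)
    ultimately show ?thesis
      unfolding Phi_form_def by (simp only: sum.Plus finite_atLeastAtMost finite_lessThan o_def)
  qed
  have 2: "(L2_set (\<lambda>i. cmod (p v i)) ?I)\<^sup>2 = interference_power K a N0 h v" if "v \<in> carrier_vec n" for v
  proof -
    have "(L2_set (\<lambda>i. cmod (p v i)) ?I)\<^sup>2 = (\<Sum>i\<in>?I. (cmod (p v i))\<^sup>2)"
      by (simp add: L2_set_def sum_nonneg)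
    also have "\<dots> = interference_power K a N0 h v"
      using a assms(2) by (simp add: sum.Plus p_def interference_power_def norm_mult power_mult_distrib
          l2norm_square[OF that] sum_distrib_left)
    finally show ?thesis .
  qed
  have "(cmod (Phi_form K a N0 h w u))\<^sup>2 \<le> (L2_set (\<lambda>i. cmod (p w i)) ?I * L2_set (\<lambda>i. cmod (p u i)) ?I)\<^sup>2"
    unfolding 1 by (intro power_mono cmod_sum_product_le) simp
  then show ?thesis unfolding power_mult_distrib 2[OF w] 2[OF u] .
qed

text \<open>The noise term is positive away from 0 and the other summands are nonnegative.\<close>

lemma interference_power_pos:
  assumes a: "\<forall>k\<in>{1..K}. a k \<ge> 0" and "N0 > 0" and u: "u \<in> carrier_vec n" "u \<noteq> 0\<^sub>v n"
  shows "interference_power K a N0 h u > 0"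
proof -
  have "(l2norm u)\<^sup>2 > 0" using l2norm_eq_0_iff[OF u(1)] u(2) by simp
  then show ?thesis unfolding interference_power_def
    using assms by (intro add_nonneg_pos sum_nonneg) auto
qed

text \<open>A nonzero kernel vector would have zero interference power, contradicting positive
  definiteness.\<close>

lemma Phi_mat_inverse:
  assumes a: "\<forall>k\<in>{1..K}. a k \<ge> 0" and N0: "N0 > 0" and h: "\<forall>k\<in>{1..K}. h k \<in> carrier_vec n"
  defines "\<Phi> \<equiv> Phi_mat n K a N0 h"
  shows "invertible_mat \<Phi>" "\<Phi> * minv \<Phi> = 1\<^sub>m n" "minv \<Phi> \<in> carrier_mat n n"
proof -
  have c: "\<Phi> \<in> carrier_mat n n" unfolding \<Phi>_def by (rule Phi_mat_carrier)
  have "det \<Phi> \<noteq> 0"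
  proof
    assume "det \<Phi> = 0"
    then obtain v where v: "v \<in> carrier_vec n" "v \<noteq> 0\<^sub>v n" "\<Phi> *\<^sub>v v = 0\<^sub>v n"
      using det_0_iff_vec_prod_zero[OF c] by auto
    then have "Phi_form K a N0 h v v = 0"
      using Phi_mat_mult_cscalar_prod[OF h v(1) v(1), of a N0] by (simp add: \<Phi>_def)
    then show False using interference_power_pos[OF a N0 v(1,2)] Phi_form_self[of K a N0 h v]
      by (metis less_irrefl of_real_eq_0_iff)
  qed
  then have "\<Phi> \<in> Units (ring_mat TYPE(complex) n ())"
    using c by (intro det_non_zero_imp_unit)
  \<comment> \<open>Being a unit rules out \<open>None\<close>, so that the \<open>the\<close> in
    \<open>minv\<close> returns an actual inverse.\<close>
  then obtain B where B: "mat_inverse \<Phi> = Some B"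
    using mat_inverse(1)[OF c, of "()"] by (cases "mat_inverse \<Phi>") auto
  note inv = mat_inverse(2)[OF c B]
  show "\<Phi> * minv \<Phi> = 1\<^sub>m n" "minv \<Phi> \<in> carrier_mat n n"
    using inv by (auto simp: minv_def B)
  show "invertible_mat \<Phi>"
    unfolding invertible_mat_def inverts_mat_def using inv c by auto
qed

lemma l2norm_smult: "l2norm (c \<cdot>\<^sub>v v) = cmod c * l2norm v"
proof -
  have "L2_set (\<lambda>i. cmod ((c \<cdot>\<^sub>v v) $ i)) {..<dim_vec v} = L2_set (\<lambda>i. cmod c * cmod (v $ i)) {..<dim_vec v}"
    by (rule L2_set_cong) (auto simp: norm_mult)
  then show ?thesis by (simp add: l2norm_def L2_set_right_distrib)
qed

section \<open>The maximal SINR for a fixed transmit vector\<close>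

context
  fixes n K :: nat and a :: "nat \<Rightarrow> real" and N0 aSS :: real and h :: "nat \<Rightarrow> complex vec"
    and B :: "complex mat" and m :: nat
  assumes a: "\<forall>k\<in>{1..K}. a k \<ge> 0" and N0: "N0 > 0" and h: "\<forall>k\<in>{1..K}. h k \<in> carrier_vec n"
    and aSS: "aSS > 0" and B: "B \<in> carrier_mat n m" and n: "n \<ge> 1"
begin

abbreviation (input) "receiver t \<equiv> minv (Phi_mat n K a N0 h) *\<^sub>v (B *\<^sub>v t)"

lemma receiver_carrier: "t \<in> carrier_vec m \<Longrightarrow> receiver t \<in> carrier_vec n"
  using Phi_mat_inverse[OF a N0 h] B by auto

text \<open>Applying \<Phi> to the receiver returns \<open>B *\<^sub>v t\<close>, so the received
  signal is a \<Phi>-inner product with the receiver.\<close>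

lemma cscalar_prod_receiver:
  assumes t: "t \<in> carrier_vec m" and u: "u \<in> carrier_vec n"
  shows "(B *\<^sub>v t) \<bullet>c u = Phi_form K a N0 h (receiver t) u"
proof -
  have g: "B *\<^sub>v t \<in> carrier_vec n" using B t by auto
  have "Phi_mat n K a N0 h *\<^sub>v receiver t = B *\<^sub>v t"
    using assoc_mult_mat_vec[OF Phi_mat_carrier Phi_mat_inverse(3)[OF a N0 h] g, of K a N0 h]
      Phi_mat_inverse(2)[OF a N0 h] g by simp
  then show ?thesis
    using Phi_mat_mult_cscalar_prod[OF h receiver_carrier[OF t] u] by metis
qed

text \<open>The unit norm turns the bare noise \<open>N0\<close> into the homogeneous term; swapping
  the arguments of \<open>h k \<bullet>c u\<close> only conjugates it.\<close>

lemma sinr_unit: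
  assumes u: "u \<in> unit_sphere n" and t: "t \<in> carrier_vec m"
  shows "sinr K aSS a N0 B h t u =
    aSS * (cmod (Phi_form K a N0 h (receiver t) u))\<^sup>2 / interference_power K a N0 h u"
proof -
  have u': "u \<in> carrier_vec n" "l2norm u = 1" using u by (auto simp: unit_sphere_def)
  have "cmod (h k \<bullet>c u) = cmod (u \<bullet>c h k)" if "k \<in> {1..K}" for k
    using cscalar_prod_swap[of "h k" n u] that h u' by (metis complex_mod_cnj)
  then show ?thesis
    unfolding sinr_def cscalar_prod_receiver[OF t u'(1)] interference_power_def by (simp add: u')
qed

lemma sinr_le:
  assumes u: "u \<in> unit_sphere n" and t: "t \<in> carrier_vec m"
  shows "sinr K aSS a N0 B h t u \<le> aSS * interference_power K a N0 h (receiver t)"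
proof -
  have u': "u \<in> carrier_vec n" "u \<noteq> 0\<^sub>v n"
    using u l2norm_eq_0_iff[of u n] by (auto simp: unit_sphere_def)
  have pos: "interference_power K a N0 h u > 0"
    by (rule interference_power_pos[OF a N0 u'])
  have "(cmod (Phi_form K a N0 h (receiver t) u))\<^sup>2 \<le>
      interference_power K a N0 h (receiver t) * interference_power K a N0 h u"
    using N0 by (intro Phi_form_Cauchy_Schwarz[OF a _ receiver_carrier[OF t] u'(1)]) simp
  then have "aSS * (cmod (Phi_form K a N0 h (receiver t) u))\<^sup>2 \<le>
      aSS * (interference_power K a N0 h (receiver t) * interference_power K a N0 h u)"
    using aSS by (intro mult_left_mono) auto
  then show ?thesis unfolding sinr_unit[OF u t] using pos by (simp add: divide_le_eq mult.assoc)
qed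

text \<open>The equality case of Cauchy--Schwarz: \<open>u\<close> is a positive multiple of the
  receiver.\<close>

lemma sinr_receiver:
  assumes t: "t \<in> carrier_vec m" and nz: "B *\<^sub>v t \<noteq> 0\<^sub>v n"
  defines "u \<equiv> complex_of_real (1 / l2norm (receiver t)) \<cdot>\<^sub>v receiver t"
  shows "u \<in> unit_sphere n" "sinr K aSS a N0 B h t u = aSS * interference_power K a N0 h (receiver t)"
proof -
  let ?w = "receiver t"
  have w: "?w \<in> carrier_vec n" by (rule receiver_carrier[OF t])
  have g: "B *\<^sub>v t \<in> carrier_vec n" using B t by auto
  have "Phi_mat n K a N0 h *\<^sub>v ?w = B *\<^sub>v t"
    using assoc_mult_mat_vec[OF Phi_mat_carrier Phi_mat_inverse(3)[OF a N0 h] g, of K a N0 h]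
      Phi_mat_inverse(2)[OF a N0 h] g by simp
  \<comment> \<open>Since \<Phi> maps the receiver to a nonzero vector and 0 to 0, the receiver can
    be normalized.\<close>
  moreover have "Phi_mat n K a N0 h *\<^sub>v 0\<^sub>v n = 0\<^sub>v n"
    by (rule mult_mat_vec_zero) (rule Phi_mat_carrier)
  ultimately have w0: "?w \<noteq> 0\<^sub>v n" using nz by auto
  have l: "l2norm ?w > 0" using l2norm_eq_0_iff[OF w] w0 l2norm_nonneg[of ?w] by simp
  show u: "u \<in> unit_sphere n"
    using l w by (auto simp: unit_sphere_def u_def l2norm_smult norm_divide)
  define c where "c = 1 / l2norm ?w"
  have c: "c > 0" using l by (simp add: c_def)
  have u': "u = complex_of_real c \<cdot>\<^sub>v ?w" by (simp add: u_def c_def)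
  have uh: "u \<bullet>c h k = of_real c * (?w \<bullet>c h k)" if "k \<in> {1..K}" for k
    using smult_cscalar_prod[OF w] h that unfolding u' by auto
  have ip: "interference_power K a N0 h u = c\<^sup>2 * interference_power K a N0 h ?w"
  proof -
    have "(\<Sum>k = 1..K. a k * (cmod (u \<bullet>c h k))\<^sup>2) = c\<^sup>2 * (\<Sum>k = 1..K. a k * (cmod (?w \<bullet>c h k))\<^sup>2)"
      unfolding sum_distrib_left
      by (intro sum.cong refl) (simp add: uh norm_mult power_mult_distrib del: atLeastAtMost_iff)
    then show ?thesis
      unfolding interference_power_def u' l2norm_smult
      by (simp add: power_mult_distrib distrib_left)
  qed
  \<comment> \<open>The scalar sits in the conjugated argument but is real, so it comes out
    unchanged.\<close>
  have uw: "?w \<bullet>c u = of_real c * (?w \<bullet>c ?w)"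
  proof -
    have "u \<in> carrier_vec n" using w by (simp add: u')
    then have "?w \<bullet>c u = cnj (u \<bullet>c ?w)"
      using w by (intro cscalar_prod_swap[symmetric])
    also have "u \<bullet>c ?w = of_real c * (?w \<bullet>c ?w)"
      unfolding u' by (rule smult_cscalar_prod[OF w w])
    finally show ?thesis by (simp add: cscalar_prod_self)
  qed
  have "Phi_form K a N0 h ?w u = of_real c * Phi_form K a N0 h ?w ?w"
  proof -
    have "(\<Sum>k = 1..K. of_real (a k) * (?w \<bullet>c h k) * cnj (u \<bullet>c h k)) =
        of_real c * (\<Sum>k = 1..K. of_real (a k) * (?w \<bullet>c h k) * cnj (?w \<bullet>c h k))"
      unfolding sum_distrib_left by (intro sum.cong refl) (simp add: uh del: atLeastAtMost_iff)
    then show ?thesis unfolding Phi_form_def uw by (simp add: distrib_left)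
  qed
  then have pf: "cmod (Phi_form K a N0 h ?w u) = c * interference_power K a N0 h ?w"
    using c interference_power_pos[OF a N0 w w0, of h] by (simp add: Phi_form_self norm_mult)
  show "sinr K aSS a N0 B h t u = aSS * interference_power K a N0 h ?w"
    unfolding sinr_unit[OF u t] ip pf using c interference_power_pos[OF a N0 w w0, of h]
    by (simp add: field_simps power2_eq_square)
qed

text \<open>After the congruence the form is the conjugate of the signal received by the
  unnormalized receiver, which is real.\<close>

lemma quad_form_A_mat:
  assumes t: "t \<in> carrier_vec m"
  shows "quad_form (A_mat aSS B (Phi_mat n K a N0 h)) t = of_real (aSS * interference_power K a N0 h (receiver t))"
proof -
  note M = Phi_mat_inverse(3)[OF a N0 h]
  have g: "B *\<^sub>v t \<in> carrier_vec n" using B t by auto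
  have "mat_adjoint B * minv (Phi_mat n K a N0 h) * B \<in> carrier_mat m m"
    using mat_adjoint_carrier[OF B] M B by auto
  then have "quad_form (A_mat aSS B (Phi_mat n K a N0 h)) t = of_real aSS * quad_form (minv (Phi_mat n K a N0 h)) (B *\<^sub>v t)"
    unfolding A_mat_def by (simp only: quad_form_smult[OF _ t] quad_form_congruence[OF B M t])
  also have "quad_form (minv (Phi_mat n K a N0 h)) (B *\<^sub>v t) = cnj ((B *\<^sub>v t) \<bullet>c receiver t)"
    unfolding quad_form_def by (rule cscalar_prod_swap[OF g receiver_carrier[OF t], symmetric])
  also have "\<dots> = of_real (interference_power K a N0 h (receiver t))"
    unfolding cscalar_prod_receiver[OF t receiver_carrier[OF t]] Phi_form_self by simp
  finally show ?thesis by simp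
qed

lemma unit_sphere_nonempty: "unit_vec n 0 \<in> unit_sphere n"
proof -
  have "(\<Sum>i<n. (cmod (unit_vec n 0 $ i))\<^sup>2) = (\<Sum>i<n. if i = 0 then 1 else 0)"
    by (intro sum.cong) auto
  then show ?thesis using n by (simp add: unit_sphere_def l2norm_def L2_set_def)
qed

lemma is_arg_max_receiver:
  assumes t: "t \<in> carrier_vec m" and nz: "B *\<^sub>v t \<noteq> 0\<^sub>v n"
  shows "is_arg_max (sinr K aSS a N0 B h t) (\<lambda>u. u \<in> unit_sphere n)
     (complex_of_real (1 / l2norm (receiver t)) \<cdot>\<^sub>v receiver t)"
  unfolding is_arg_max_linorder using sinr_receiver[OF t nz] sinr_le[OF _ t] by auto

text \<open>When \<open>B *\<^sub>v t\<close> vanishes, the receiver cannot be normalized, but the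
  SINR is 0 on the whole sphere and the form is 0 too, so any unit vector attains the
  maximum.\<close>

lemma ex_is_arg_max_sinr:
  assumes t: "t \<in> carrier_vec m"
  shows "\<exists>u. is_arg_max (sinr K aSS a N0 B h t) (\<lambda>u. u \<in> unit_sphere n) u \<and>
    complex_of_real (sinr K aSS a N0 B h t u) = quad_form (A_mat aSS B (Phi_mat n K a N0 h)) t"
proof (cases "B *\<^sub>v t = 0\<^sub>v n")
  case False
  then show ?thesis
    using is_arg_max_receiver[OF t] sinr_receiver(2)[OF t] quad_form_A_mat[OF t] by auto
next
  case True
  have z: "sinr K aSS a N0 B h t u = 0" if "u \<in> unit_sphere n" for u
    using that True by (simp add: sinr_def unit_sphere_def)
  have "receiver t = 0\<^sub>v n"
    unfolding True by (rule mult_mat_vec_zero) (rule Phi_mat_inverse(3)[OF a N0 h])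
  then have "interference_power K a N0 h (receiver t) = 0"
    using h l2norm_eq_0_iff[of "0\<^sub>v n" n] by (simp add: interference_power_def)
  then show ?thesis
    using unit_sphere_nonempty z quad_form_A_mat[OF t]
    by (intro exI[of _ "unit_vec n 0"]) (auto simp: is_arg_max_linorder)
qed

end

section \<open>Equivalence of the two optimization problems\<close>

text \<open>The joint maximum can be taken in two stages: feasibility splits into a condition on
  \<open>t\<close> and membership in the sphere, and the inner maximum over the sphere is attained
  with value \<open>quad_form A t\<close>. No existence of an outer maximizer is involved.\<close>

lemma same_solutionsI:
  assumes IQ: "\<forall>k\<in>{1..K}. \<forall>t\<in>carrier_vec mS. I k t \<longleftrightarrow> quad_form (Q k) t \<le> 1"
    and max: "\<forall>t\<in>carrier_vec mS. \<exists>u. is_arg_max (\<gamma> t) (\<lambda>u. u \<in> unit_sphere nS) u \<and>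
           complex_of_real (\<gamma> t u) = quad_form A t"
  shows "same_solutions mS nS K Pmax \<gamma> A I Q"
proof -
  let ?q = "\<lambda>t. Re (quad_form A t)" and ?F = "qcqp_feasible mS K Pmax Q" and ?S = "unit_sphere nS"
  have feas: "bf_feasible mS nS K Pmax I (t, u) \<longleftrightarrow> ?F t \<and> u \<in> ?S" for t u
  proof -
    have "(\<forall>k\<in>{1..K}. I k t) \<longleftrightarrow> (\<forall>k\<in>{1..K}. quad_form (Q k) t \<le> 1)" if "t \<in> carrier_vec mS"
      using IQ that by blast
    moreover have "t \<bullet>c t \<le> complex_of_real Pmax \<longleftrightarrow> (l2norm t)\<^sup>2 \<le> Pmax"
      unfolding cscalar_prod_self less_eq_complex_def Re_complex_of_real Im_complex_of_real by simp
    ultimately show ?thesis unfolding bf_feasible_def qcqp_feasible_def by auto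
  qed
  \<comment> \<open>The inner problem: the form is real, bounds the SINR and is attained.\<close>
  have opt: "(\<exists>u\<in>?S. \<gamma> t u = ?q t) \<and> (\<forall>u\<in>?S. \<gamma> t u \<le> ?q t) \<and> quad_form A t = of_real (?q t)"
    if F: "?F t" for t
  proof -
    have "t \<in> carrier_vec mS" using F by (simp add: qcqp_feasible_def)
    from bspec[OF max this] obtain u where u: "is_arg_max (\<gamma> t) (\<lambda>u. u \<in> ?S) u"
      and A: "complex_of_real (\<gamma> t u) = quad_form A t" by (elim exE conjE)
    have "?q t = \<gamma> t u" unfolding A[symmetric] by simp
    with u A show ?thesis by (auto simp: is_arg_max_linorder)
  qed
  have le: "\<gamma> t u \<le> ?q t" if "?F t" "u \<in> ?S" for t u using opt[OF that(1)] that(2) by blast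
  have ex: "\<exists>u\<in>?S. \<gamma> t u = ?q t" if "?F t" for t using opt[OF that] by blast
  have real: "quad_form A t = of_real (?q t)" if "?F t" for t using opt[OF that] by blast
  \<comment> \<open>Joint maximizers are the pairs of an outer maximizer and a unit vector attaining
    the inner maximum; both halves of \<open>same_solutions\<close> follow from this.\<close>
  have bf: "is_arg_max (\<lambda>(t, r). \<gamma> t r) (bf_feasible mS nS K Pmax I) (t, u) \<longleftrightarrow>
      is_arg_max ?q ?F t \<and> u \<in> ?S \<and> \<gamma> t u = ?q t" for t u
  proof
    assume "is_arg_max (\<lambda>(t, r). \<gamma> t r) (bf_feasible mS nS K Pmax I) (t, u)"
    then have t: "?F t" "u \<in> ?S" and ge: "\<And>t' u'. ?F t' \<Longrightarrow> u' \<in> ?S \<Longrightarrow> \<gamma> t' u' \<le> \<gamma> t u"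
      by (auto simp: is_arg_max_linorder feas)
    have ge': "?q t' \<le> \<gamma> t u" if "?F t'" for t' using ex[OF that] ge[OF that] by force
    have eq: "\<gamma> t u = ?q t" using le[OF t] ge'[OF t(1)] by (rule antisym)
    moreover have "is_arg_max ?q ?F t"
      using t(1) ge' unfolding is_arg_max_linorder eq by blast
    ultimately show "is_arg_max ?q ?F t \<and> u \<in> ?S \<and> \<gamma> t u = ?q t"
      using t(2) by blast
  next
    assume *: "is_arg_max ?q ?F t \<and> u \<in> ?S \<and> \<gamma> t u = ?q t"
    have "\<gamma> t' u' \<le> \<gamma> t u" if "?F t'" "u' \<in> ?S" for t' u'
      using le[OF that] * that(1) unfolding is_arg_max_linorder by fastforce
    then show "is_arg_max (\<lambda>(t, r). \<gamma> t r) (bf_feasible mS nS K Pmax I) (t, u)"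
      using * by (simp add: is_arg_max_linorder feas split: prod.split)
  qed
  show ?thesis unfolding same_solutions_def bf
  proof (intro conjI allI impI iffI)
    fix t assume "is_arg_max ?q ?F t"
    moreover from this have "?F t" by (simp add: is_arg_max_def)
    ultimately show "\<exists>u. is_arg_max ?q ?F t \<and> u \<in> ?S \<and> \<gamma> t u = ?q t"
      using ex by blast
  next
    fix t u assume "is_arg_max ?q ?F t \<and> u \<in> ?S \<and> \<gamma> t u = ?q t"
    then show "complex_of_real (\<gamma> t u) = quad_form A t"
      using real[of t] by (simp add: is_arg_max_def)
  qed blast
qed

section \<open>The probabilistic interference constraints\<close>

text \<open>Passage from a tail integral to the complementary probability; \<open>p \<ge> 0\<close>
  allows \<open>p\<close> to be recovered from \<open>ennreal p\<close>.\<close>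

lemma (in prob_space) prob_le_eq_1_minus_tail:
  fixes f :: "'a \<Rightarrow> real"
  assumes [measurable]: "f \<in> borel_measurable M"
    and tail: "(\<integral>\<^sup>+x. indicator {q<..} (f x) \<partial>M) = ennreal p" and p: "p \<ge> 0"
  shows "\<P>(x in M. f x \<le> q) = 1 - p"
proof -
  have "(\<integral>\<^sup>+x. indicator {q<..} (f x) \<partial>M) = (\<integral>\<^sup>+x. indicator {x\<in>space M. q < f x} x \<partial>M)"
    by (intro nn_integral_cong) (auto simp: indicator_def)
  also have "\<dots> = emeasure M {x\<in>space M. q < f x}" by (intro nn_integral_indicator) measurable
  finally have "emeasure M {x\<in>space M. q < f x} = ennreal p" using tail by simp
  then have "\<P>(x in M. q < f x) = p" using p by (simp add: measure_def)
  moreover have "\<P>(x in M. \<not> q < f x) = 1 - \<P>(x in M. q < f x)"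
    by (rule prob_neg) measurable
  ultimately show ?thesis by (simp add: not_less)
qed

lemma measurable_cnj[measurable (raw)]:
  "f \<in> borel_measurable M \<Longrightarrow> (\<lambda>x. cnj (f x)) \<in> borel_measurable M"
  by (rule measurable_compose[of f M borel cnj])
    (auto intro!: borel_measurable_continuous_onI continuous_intros)

lemma random_vec_cscalar_prod_measurable:
  assumes "random_vec M n R" "v \<in> carrier_vec n"
  shows "(\<lambda>\<omega>. v \<bullet>c R \<omega>) \<in> borel_measurable M"
proof -
  have [measurable]: "(\<lambda>\<omega>. vec_coords n (R \<omega>)) \<in> measurable M (vec_space n)"
    using assms by (simp add: random_vec_def)
  have "(\<lambda>\<omega>. \<Sum>i<n. v $ i * cnj (vec_coords n (R \<omega>) i)) \<in> borel_measurable M"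
    by measurable
  also have "?this \<longleftrightarrow> ?thesis"
    using assms by (intro measurable_cong)
      (auto simp: cscalar_prod_sum[of _ n] random_vec_def vec_coords_def intro!: sum.cong)
  finally show ?thesis .
qed

text \<open>The law of the normalized Gaussian is pulled back to the Gaussian and the norm
  multiplied out. The conjugation moves from \<open>z\<close> to \<open>v\<close>, which leaves the
  modulus unchanged.\<close>

lemma isotropic_unit_vec_tail:
  assumes R: "isotropic_unit_vec M n R" and v: "v \<in> carrier_vec n" and q: "q \<ge> 0"
  shows "(\<integral>\<^sup>+\<omega>. indicator {q<..} ((cmod (v \<bullet>c R \<omega>))\<^sup>2) \<partial>M) =
    (\<integral>\<^sup>+z. indicator {0<..} ((cmod (\<Sum>i<n. cnj (v $ i) * z i))\<^sup>2 - q * (\<Sum>i<n. (cmod (z i))\<^sup>2))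
      \<partial>PiM {..<n} (\<lambda>_. cnormal))"
proof -
  define f where "f = (\<lambda>y::nat \<Rightarrow> complex. (cmod (\<Sum>i<n. v $ i * cnj (y i)))\<^sup>2)"
  have [measurable]: "f \<in> borel_measurable (vec_space n)" unfolding f_def by measurable
  have X[measurable]: "(\<lambda>\<omega>. vec_coords n (R \<omega>)) \<in> measurable M (vec_space n)"
    and law: "distr M (vec_space n) (\<lambda>\<omega>. vec_coords n (R \<omega>)) = sphere_law n"
    and Rc: "\<And>\<omega>. \<omega> \<in> space M \<Longrightarrow> R \<omega> \<in> carrier_vec n"
    using R by (auto simp: isotropic_unit_vec_def random_vec_def)
  let ?u = "\<lambda>z. \<lambda>i\<in>{..<n}. z i / complex_of_real (L2_set (\<lambda>j. cmod (z j)) {..<n})"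
  have "(\<integral>\<^sup>+\<omega>. indicator {q<..} ((cmod (v \<bullet>c R \<omega>))\<^sup>2) \<partial>M) =
    (\<integral>\<^sup>+\<omega>. indicator {q<..} (f (vec_coords n (R \<omega>))) \<partial>M)"
    using Rc by (intro nn_integral_cong) (simp add: f_def cscalar_prod_sum[of _ n] vec_coords_def)
  also have "\<dots> = (\<integral>\<^sup>+y. indicator {q<..} (f y) \<partial>sphere_law n)"
    by (subst law[symmetric], subst nn_integral_distr) auto
  also have "\<dots> = (\<integral>\<^sup>+z. indicator {q<..} (f (?u z)) \<partial>PiM {..<n} (\<lambda>_. cnormal))"
    unfolding sphere_law_def
  proof (rule nn_integral_distr)
    show "?u \<in> measurable (PiM {..<n} (\<lambda>_. cnormal)) (vec_space n)"
      unfolding L2_set_def by measurable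
  qed measurable
  also have "\<dots> = (\<integral>\<^sup>+z. indicator {0<..} ((cmod (\<Sum>i<n. cnj (v $ i) * z i))\<^sup>2 - q * (\<Sum>i<n. (cmod (z i))\<^sup>2))
      \<partial>PiM {..<n} (\<lambda>_. cnormal))"
  proof (rule nn_integral_cong)
    fix z :: "nat \<Rightarrow> complex"
    define L where "L = L2_set (\<lambda>j. cmod (z j)) {..<n}"
    have L2: "(\<Sum>i<n. (cmod (z i))\<^sup>2) = L\<^sup>2" by (simp add: L_def L2_set_def sum_nonneg)
    have "(\<Sum>i<n. v $ i * cnj (?u z i)) = cnj (\<Sum>i<n. cnj (v $ i) * z i) / of_real L"
      by (simp add: L_def[symmetric] sum_divide_distrib)
    then have f: "f (?u z) = (cmod (\<Sum>i<n. cnj (v $ i) * z i))\<^sup>2 / L\<^sup>2"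
      unfolding f_def by (simp only: norm_divide complex_mod_cnj norm_of_real power_divide power2_abs)
    have "q < f (?u z) \<longleftrightarrow> 0 < (cmod (\<Sum>i<n. cnj (v $ i) * z i))\<^sup>2 - q * L\<^sup>2"
    \<comment> \<open>At \<open>z = 0\<close> the normalized vector is 0 by the convention on
      division by zero; both inequalities then fail because \<open>q \<ge> 0\<close>.\<close>
    proof (cases "L = 0")
      case True
      then have "\<forall>i<n. z i = 0" by (auto simp: L_def L2_set_eq_0_iff)
      then show ?thesis using q True by (simp add: f)
    next
      case False
      then have "L\<^sup>2 > 0" by simp
      then show ?thesis unfolding f by (simp add: less_divide_eq)
    qed
    then show "indicator {q<..} (f (?u z)) =
      (indicator {0<..} ((cmod (\<Sum>i<n. cnj (v $ i) * z i))\<^sup>2 - q * (\<Sum>i<n. (cmod (z i))\<^sup>2)) :: ennreal)"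
      by (simp add: indicator_def L2)
  qed
  finally show ?thesis .
qed

text \<open>If \<open>(l2norm v)\<^sup>2 \<le> q\<close>, Cauchy--Schwarz makes the event certain,
  which covers \<open>v = 0\<close>; otherwise the ratio tail applies.\<close>

lemma isotropic_unit_vec_prob:
  assumes M: "prob_space M" and R: "isotropic_unit_vec M n R" and v: "v \<in> carrier_vec n" and q: "q > 0"
  shows "\<P>(\<omega> in M. (cmod (v \<bullet>c R \<omega>))\<^sup>2 \<le> q) =
    (if (l2norm v)\<^sup>2 \<le> q then 1 else 1 - (1 - q / (l2norm v)\<^sup>2) ^ (n - 1))"
proof -
  interpret prob_space M by fact
  have [measurable]: "(\<lambda>\<omega>. v \<bullet>c R \<omega>) \<in> borel_measurable M"
    using random_vec_cscalar_prod_measurable[of M n R v] R v by (simp add: isotropic_unit_vec_def)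
  have L: "L2_set (\<lambda>i. cmod (cnj (v $ i))) {..<n} = l2norm v" using v by (simp add: l2norm_def)
  have "(\<integral>\<^sup>+\<omega>. indicator {q<..} ((cmod (v \<bullet>c R \<omega>))\<^sup>2) \<partial>M) =
    ennreal (if (l2norm v)\<^sup>2 \<le> q then 0 else (1 - q / (l2norm v)\<^sup>2) ^ (n - 1))"
  proof (cases "(l2norm v)\<^sup>2 \<le> q")
    case True
    have "(cmod (\<Sum>i<n. cnj (v $ i) * z i))\<^sup>2 - q * (\<Sum>i<n. (cmod (z i))\<^sup>2) \<le> 0" for z
    proof -
      have "cmod (\<Sum>i<n. cnj (v $ i) * z i) \<le> l2norm v * L2_set (\<lambda>i. cmod (z i)) {..<n}"
        using cmod_sum_product_le[of "\<lambda>i. cnj (v $ i)" "\<lambda>i. cnj (z i)" "{..<n}"] by (simp add: L[simplified])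
      then have "(cmod (\<Sum>i<n. cnj (v $ i) * z i))\<^sup>2 \<le> (l2norm v)\<^sup>2 * (L2_set (\<lambda>i. cmod (z i)) {..<n})\<^sup>2"
        unfolding power_mult_distrib[symmetric] by (rule power_mono) simp
      also have "\<dots> \<le> q * (L2_set (\<lambda>i. cmod (z i)) {..<n})\<^sup>2"
        using True by (intro mult_right_mono) auto
      finally show ?thesis by (simp add: L2_set_def sum_nonneg)
    qed
    then have "(indicator {0<..} ((cmod (\<Sum>i<n. cnj (v $ i) * z i))\<^sup>2 - q * (\<Sum>i<n. (cmod (z i))\<^sup>2)) :: ennreal) = 0" for z
      by (metis greaterThan_iff indicator_simps(2) not_less)
    then show ?thesis using True
      unfolding isotropic_unit_vec_tail[OF R v less_imp_le[OF q]] by (simp only: nn_integral_const mult_zero_left if_True ennreal_0)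
  next
    case False
    then have pos: "l2norm v > 0" using q l2norm_nonneg[of v] by (cases "l2norm v = 0") auto
    \<comment> \<open>The ratio tail with \<open>x = q / (l2norm v)\<^sup>2\<close>, which lies
      strictly between 0 and 1 in this case; multiplying by the squared norm gives back
      \<open>q\<close>.\<close>
    have "(\<integral>\<^sup>+z. indicator {0<..} ((cmod (\<Sum>i<n. cnj (v $ i) * z i))\<^sup>2 -
        q / (l2norm v)\<^sup>2 * (l2norm v)\<^sup>2 * (\<Sum>i<n. (cmod (z i))\<^sup>2)) \<partial>PiM {..<n} (\<lambda>_. cnormal)) =
      ennreal ((1 - q / (l2norm v)\<^sup>2) ^ (n - 1))"
      using PiM_cnormal_ratio_tail[of "{..<n}" "\<lambda>i. cnj (v $ i)" "q / (l2norm v)\<^sup>2"] pos q False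
      unfolding L by simp
    then show ?thesis using False pos
      unfolding isotropic_unit_vec_tail[OF R v less_imp_le[OF q]] by simp
  qed
  note t = prob_le_eq_1_minus_tail[OF _ this]
  have "0 \<le> (if (l2norm v)\<^sup>2 \<le> q then 0 else (1 - q / (l2norm v)\<^sup>2) ^ (n - 1))"
    using q by (auto simp: divide_le_eq intro!: zero_le_power)
  from t[OF _ this] show ?thesis by auto
qed

section \<open>Independence and the Gaussian channel of Scenario 3\<close>

text \<open>The two measures agree on rectangles, whose sides pull back to events of the two
  generated sigma-algebras.\<close>

lemma (in prob_space) distr_Pair_eq_pair_measure:
  assumes [measurable]: "X \<in> measurable M A" "Y \<in> measurable M B"
    and ind: "indep_set (sets (vimage_algebra (space M) X A)) (sets (vimage_algebra (space M) Y B))"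
  shows "distr M (A \<Otimes>\<^sub>M B) (\<lambda>\<omega>. (X \<omega>, Y \<omega>)) = distr M A X \<Otimes>\<^sub>M distr M B Y"
proof (rule pair_measure_eqI[symmetric])
  interpret X: prob_space "distr M A X" by (rule prob_space_distr) fact
  interpret Y: prob_space "distr M B Y" by (rule prob_space_distr) fact
  show "sigma_finite_measure (distr M A X)" "sigma_finite_measure (distr M B Y)" by unfold_locales
  show "sets (distr M A X \<Otimes>\<^sub>M distr M B Y) = sets (distr M (A \<Otimes>\<^sub>M B) (\<lambda>\<omega>. (X \<omega>, Y \<omega>)))"
    by (simp cong: sets_pair_measure_cong)
  fix a b assume "a \<in> sets (distr M A X)" "b \<in> sets (distr M B Y)"
  then have [measurable]: "a \<in> sets A" "b \<in> sets B" by auto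
  have "prob ((X -` a \<inter> space M) \<inter> (Y -` b \<inter> space M)) = prob (X -` a \<inter> space M) * prob (Y -` b \<inter> space M)"
    by (rule indep_setD[OF ind]) (auto intro: in_vimage_algebra)
  moreover have "(\<lambda>\<omega>. (X \<omega>, Y \<omega>)) -` (a \<times> b) \<inter> space M = (X -` a \<inter> space M) \<inter> (Y -` b \<inter> space M)"
    by auto
  ultimately show "emeasure (distr M A X) a * emeasure (distr M B Y) b =
      emeasure (distr M (A \<Otimes>\<^sub>M B) (\<lambda>\<omega>. (X \<omega>, Y \<omega>))) (a \<times> b)"
    by (simp add: emeasure_distr emeasure_eq_measure ennreal_mult[symmetric])
qed

text \<open>Independence makes the joint law the product of the marginals; \<open>m \<ge> 1\<close>
  and \<open>n \<ge> 1\<close> make the index set nonempty, as the characterization used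
  requires.\<close>

lemma iid_cnormal_mat_distr:
  assumes M: "prob_space M" and G: "iid_cnormal_mat M m n G" and "m \<ge> 1" "n \<ge> 1"
  shows "distr M (mat_space m n) (\<lambda>\<omega>. mat_coords m n (G \<omega>)) = PiM ({..<m} \<times> {..<n}) (\<lambda>_. cnormal)"
proof -
  interpret prob_space M by fact
  let ?I = "{..<m} \<times> {..<n}"
  have X[measurable]: "(\<lambda>\<omega>. mat_coords m n (G \<omega>)) \<in> measurable M (mat_space m n)"
    and ind: "indep_vars (\<lambda>_. borel) (\<lambda>ij \<omega>. G \<omega> $$ ij) ?I"
    and law: "\<And>ij. ij \<in> ?I \<Longrightarrow> distr M borel (\<lambda>\<omega>. G \<omega> $$ ij) = cnormal"
    using G by (auto simp: iid_cnormal_mat_def random_mat_def)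
  have rv: "(\<lambda>\<omega>. G \<omega> $$ ij) \<in> borel_measurable M" if "ij \<in> ?I" for ij
    using measurable_component_singleton[OF that, of "\<lambda>_. borel", THEN measurable_compose[OF X]] that
    by (simp add: mat_coords_def)
  have ne: "?I \<noteq> {}" using assms(3,4) by (auto simp: lessThan_empty_iff)
  have "distr M (mat_space m n) (\<lambda>\<omega>. \<lambda>ij\<in>?I. G \<omega> $$ ij) = PiM ?I (\<lambda>ij. distr M borel (\<lambda>\<omega>. G \<omega> $$ ij))"
    by (rule iffD1[OF indep_vars_iff_distr_eq_PiM'[OF ne rv] ind])
  also have "\<dots> = PiM ?I (\<lambda>_. cnormal)" by (rule PiM_cong[OF refl law])
  finally show ?thesis by (simp add: mat_coords_def)
qed

text \<open>For a fixed unit beamformer the received value is a linear form in the Gaussian entries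
  whose coefficient norm is \<open>l2norm t\<close>. The conditional tail is therefore the same for
  every beamformer, whatever its law.\<close>

lemma iid_cnormal_mat_prob:
  assumes M: "prob_space M" and G: "iid_cnormal_mat M m n G" and mn: "m \<ge> 1" "n \<ge> 1"
    and R: "random_vec M m R" and unit: "\<forall>\<omega>\<in>space M. R \<omega> \<in> unit_sphere m"
    and ind: "indep_mat_vec M m n G R"
    and t: "t \<in> carrier_vec n" "t \<noteq> 0\<^sub>v n" and q: "q \<ge> 0"
  shows "\<P>(\<omega> in M. (cmod ((G \<omega> *\<^sub>v t) \<bullet>c R \<omega>))\<^sup>2 \<le> q) = 1 - exp (- (q / (l2norm t)\<^sup>2))"
proof -
  interpret prob_space M by fact
  let ?I = "{..<m} \<times> {..<n}"
  define X where "X = (\<lambda>\<omega>. mat_coords m n (G \<omega>))"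
  define Y where "Y = (\<lambda>\<omega>. vec_coords m (R \<omega>))"
  \<comment> \<open>The received power in terms of the two coordinate families, with
    \<open>t $ j * cnj (r $ i)\<close> as the coefficient of entry \<open>(i, j)\<close>.\<close>
  define F where "F = (\<lambda>p. (cmod (\<Sum>ij\<in>?I. (t $ snd ij * cnj (snd p (fst ij))) * fst p ij))\<^sup>2)"
  have [measurable]: "F \<in> borel_measurable (mat_space m n \<Otimes>\<^sub>M vec_space m)"
  proof -
    have "(\<lambda>p. snd p (fst ij)) \<in> borel_measurable (mat_space m n \<Otimes>\<^sub>M vec_space m)"
      "(\<lambda>p. fst p ij) \<in> borel_measurable (mat_space m n \<Otimes>\<^sub>M vec_space m)" if "ij \<in> ?I" for ij
      using that by (auto intro!: measurable_compose[OF measurable_fst] measurable_compose[OF measurable_snd]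
          measurable_component_singleton)
    then have [measurable]: "(\<lambda>p. \<Sum>ij\<in>?I. t $ snd ij * cnj (snd p (fst ij)) * fst p ij) \<in>
        borel_measurable (mat_space m n \<Otimes>\<^sub>M vec_space m)"
      by (intro borel_measurable_sum borel_measurable_times borel_measurable_const measurable_cnj)
    show ?thesis unfolding F_def by measurable
  qed
  have X[measurable]: "X \<in> measurable M (mat_space m n)" and Gc: "\<And>\<omega>. \<omega> \<in> space M \<Longrightarrow> G \<omega> \<in> carrier_mat m n"
    using G by (auto simp: iid_cnormal_mat_def random_mat_def X_def)
  have Y[measurable]: "Y \<in> measurable M (vec_space m)" and Rc: "\<And>\<omega>. \<omega> \<in> space M \<Longrightarrow> R \<omega> \<in> carrier_vec m"
    using R by (auto simp: random_vec_def Y_def)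
  have lawX: "distr M (mat_space m n) X = PiM ?I (\<lambda>_. cnormal)"
    unfolding X_def by (rule iid_cnormal_mat_distr[OF M G mn])
  interpret dX: prob_space "PiM ?I (\<lambda>_. cnormal)" by (rule prob_space_PiM) (rule prob_space_cnormal)
  interpret dY: prob_space "distr M (vec_space m) Y" by (rule prob_space_distr) fact
  interpret XY: pair_sigma_finite "PiM ?I (\<lambda>_. cnormal)" "distr M (vec_space m) Y" ..
  have joint: "distr M (mat_space m n \<Otimes>\<^sub>M vec_space m) (\<lambda>\<omega>. (X \<omega>, Y \<omega>)) =
      PiM ?I (\<lambda>_. cnormal) \<Otimes>\<^sub>M distr M (vec_space m) Y"
    using distr_Pair_eq_pair_measure[OF X Y] ind lawX by (simp add: indep_mat_vec_def X_def Y_def)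
  have F: "(cmod ((G \<omega> *\<^sub>v t) \<bullet>c R \<omega>))\<^sup>2 = F (X \<omega>, Y \<omega>)" if "\<omega> \<in> space M" for \<omega>
  proof -
    have "(G \<omega> *\<^sub>v t) \<bullet>c R \<omega> = (\<Sum>i<m. (\<Sum>j<n. G \<omega> $$ (i, j) * t $ j) * cnj (R \<omega> $ i))"
      by (simp add: cscalar_prod_sum[OF Rc[OF that]] mult_mat_vec_index_sum[OF Gc[OF that] t(1)] del: index_mult_mat_vec)
    also have "\<dots> = (\<Sum>ij\<in>?I. (t $ snd ij * cnj (Y \<omega> (fst ij))) * X \<omega> ij)"
      by (auto simp: sum.cartesian_product' sum_distrib_left sum_distrib_right X_def Y_def mat_coords_def vec_coords_def mult_ac
          intro!: sum.cong)
    finally show ?thesis by (simp add: F_def)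
  qed
  have Fm[measurable]: "(\<lambda>\<omega>. F (X \<omega>, Y \<omega>)) \<in> borel_measurable M" by measurable
  have l: "l2norm t > 0" using l2norm_eq_0_iff[OF t(1)] t(2) l2norm_nonneg[of t] by simp
  have "(\<integral>\<^sup>+\<omega>. indicator {q<..} (F (X \<omega>, Y \<omega>)) \<partial>M) =
    (\<integral>\<^sup>+p. indicator {q<..} (F p) \<partial>(PiM ?I (\<lambda>_. cnormal) \<Otimes>\<^sub>M distr M (vec_space m) Y))"
    by (subst joint[symmetric], subst nn_integral_distr) auto
  \<comment> \<open>The channel entries are integrated inside, which is the conditioning on the
    beamformer.\<close>
  also have "\<dots> = (\<integral>\<^sup>+y. \<integral>\<^sup>+x. indicator {q<..} (F (x, y)) \<partial>PiM ?I (\<lambda>_. cnormal) \<partial>distr M (vec_space m) Y)"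
  proof (rule XY.nn_integral_snd[symmetric])
    show "(\<lambda>p. indicator {q<..} (F p) :: ennreal) \<in> borel_measurable (PiM ?I (\<lambda>_. cnormal) \<Otimes>\<^sub>M distr M (vec_space m) Y)"
      unfolding joint[symmetric] by measurable
  qed
  also have "\<dots> = (\<integral>\<^sup>+\<omega>. \<integral>\<^sup>+x. indicator {q<..} (F (x, Y \<omega>)) \<partial>PiM ?I (\<lambda>_. cnormal) \<partial>M)"
  proof (rule nn_integral_distr[OF Y])
    have [measurable_cong]: "sets (PiM ?I (\<lambda>_. cnormal)) = sets (mat_space m n)"
      by (intro sets_PiM_cong) auto
    show "(\<lambda>y. \<integral>\<^sup>+x. indicator {q<..} (F (x, y)) \<partial>PiM ?I (\<lambda>_. cnormal)) \<in>
        borel_measurable (distr M (vec_space m) Y)"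
      by measurable
  qed
  also have "\<dots> = (\<integral>\<^sup>+\<omega>. ennreal (exp (- (q / (l2norm t)\<^sup>2))) \<partial>M)"
  proof (rule nn_integral_cong)
    fix \<omega> assume \<omega>: "\<omega> \<in> space M"
    let ?v = "\<lambda>ij. t $ snd ij * cnj (Y \<omega> (fst ij))"
    have "l2norm (R \<omega>) = 1" using unit \<omega> by (simp add: unit_sphere_def)
    \<comment> \<open>The coefficients form a rank-one array, so their squared norm is a product of
      squared norms.\<close>
    moreover have "(L2_set (\<lambda>ij. cmod (?v ij)) ?I)\<^sup>2 = (\<Sum>i<m. (cmod (R \<omega> $ i))\<^sup>2) * (\<Sum>j<n. (cmod (t $ j))\<^sup>2)"
    proof -
      have "(L2_set (\<lambda>ij. cmod (?v ij)) ?I)\<^sup>2 = (\<Sum>ij\<in>?I. (cmod (?v ij))\<^sup>2)"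
        by (simp add: L2_set_def sum_nonneg)
      also have "\<dots> = (\<Sum>(i, j)\<in>?I. (cmod (R \<omega> $ i))\<^sup>2 * (cmod (t $ j))\<^sup>2)"
        by (intro sum.cong) (auto simp: norm_mult power_mult_distrib Y_def vec_coords_def)
      also have "\<dots> = (\<Sum>i<m. (cmod (R \<omega> $ i))\<^sup>2) * (\<Sum>j<n. (cmod (t $ j))\<^sup>2)"
        by (simp only: sum_product sum.cartesian_product)
      finally show ?thesis .
    qed
    ultimately have "(L2_set (\<lambda>ij. cmod (?v ij)) ?I)\<^sup>2 = (l2norm t)\<^sup>2"
      using l2norm_square[OF Rc[OF \<omega>]] l2norm_square[OF t(1)] by simp
    then have "L2_set (\<lambda>ij. cmod (?v ij)) ?I = l2norm t" using l by simp
    then show "(\<integral>\<^sup>+x. indicator {q<..} (F (x, Y \<omega>)) \<partial>PiM ?I (\<lambda>_. cnormal)) = ennreal (exp (- (q / (l2norm t)\<^sup>2)))"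
      using PiM_cnormal_linear_tail[of ?I ?v q] l q by (simp add: F_def)
  qed
  also have "\<dots> = ennreal (exp (- (q / (l2norm t)\<^sup>2)))" by (simp add: emeasure_space_1)
  finally have "\<P>(\<omega> in M. F (X \<omega>, Y \<omega>) \<le> q) = 1 - exp (- (q / (l2norm t)\<^sup>2))"
    by (rule prob_le_eq_1_minus_tail[OF Fm]) simp
  also have "\<P>(\<omega> in M. F (X \<omega>, Y \<omega>) \<le> q) = \<P>(\<omega> in M. (cmod ((G \<omega> *\<^sub>v t) \<bullet>c R \<omega>))\<^sup>2 \<le> q)"
    by (intro arg_cong[where f = "measure M"]) (auto simp: F)
  finally show ?thesis .
qed

section \<open>The interference constraints as quadratic inequalities\<close>

lemma constraint1_iff:
  assumes "a k > 0" "\<epsilon> k > 0" "H k \<in> carrier_mat m n" "r k \<in> unit_sphere m" "t \<in> carrier_vec n"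
  shows "constraint1 a \<epsilon> H r k t \<longleftrightarrow> quad_form (Q1 a \<epsilon> H r k) t \<le> 1"
proof -
  have "r k \<in> carrier_vec m" using assms by (simp add: unit_sphere_def)
  from quad_form_Q1[where a = a and H = H and k = k and r = r, OF assms(3) this assms(5)] show ?thesis
    using assms(2) by (simp add: less_eq_complex_def constraint1_def interference_def divide_le_eq)
qed

text \<open>Taking \<open>m\<close>-th roots turns \<open>(1 - q / s) ^ m \<le> \<delta> k\<close>
  into the inequality \<open>1 - q / s \<le> d\<close>, which is linear in \<open>s\<close> after
  clearing the denominator.\<close>

lemma constraint2_iff:
  assumes M: "prob_space M" and pos: "a k > 0" "\<epsilon> k > 0" and H: "H k \<in> carrier_mat (N k) n" and N: "N k \<ge> 2"
    and \<delta>: "0 < \<delta> k" "\<delta> k < 1" and R: "isotropic_unit_vec M (N k) (R k)" and t: "t \<in> carrier_vec n"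
  shows "constraint2 M a \<epsilon> \<delta> H R k t \<longleftrightarrow> quad_form (Q2 N a \<epsilon> \<delta> H k) t \<le> 1"
proof -
  define v where "v = H k *\<^sub>v t"
  have v: "v \<in> carrier_vec (N k)" using H t by (auto simp: v_def)
  define s where "s = (l2norm v)\<^sup>2"
  define q where "q = \<epsilon> k / a k"
  have q: "q > 0" using pos by (simp add: q_def)
  \<comment> \<open>\<open>N k \<ge> 2\<close> gives \<open>m \<ge> 1\<close>, so the root
    \<open>d\<close> makes sense; \<open>Q2\<close> subtracts 1 in the reals, the tail exponent in
    the naturals.\<close>
  define m where "m = N k - 1"
  have m: "m \<ge> 1" "real (N k) - 1 = real m" using N by (auto simp: m_def)
  define d where "d = \<delta> k powr (1 / real m)"
  have d: "d > 0" "d ^ m = \<delta> k"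
    using \<delta> m by (auto simp: d_def powr_realpow[symmetric] powr_powr)
  have d1: "d < 1" using d(2) \<delta> one_le_power[of d m] by linarith
  have "interference (a k) (H k) (R k \<omega>) t \<le> \<epsilon> k \<longleftrightarrow> (cmod (v \<bullet>c R k \<omega>))\<^sup>2 \<le> q" for \<omega>
    using pos by (simp add: interference_def v_def q_def le_divide_eq mult.commute)
  then have "constraint2 M a \<epsilon> \<delta> H R k t \<longleftrightarrow> 1 - \<delta> k \<le> (if s \<le> q then 1 else 1 - (1 - q / s) ^ m)"
    using isotropic_unit_vec_prob[OF M R v q] by (simp add: constraint2_def s_def m_def)
  also have "\<dots> \<longleftrightarrow> (1 - d) * s \<le> q"
  proof (cases "s \<le> q")
    \<comment> \<open>Here the constraint holds with probability 1, and the quadratic inequality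
      holds as well because \<open>1 - d < 1\<close>.\<close>
    case True
    have "(1 - d) * s \<le> 1 * s" using d d1 by (intro mult_right_mono) (auto simp: s_def)
    then show ?thesis using True \<delta> by simp
  next
    case False
    then have s: "s > 0" "0 \<le> 1 - q / s" using q by (auto simp: divide_le_eq)
    have "(1 - q / s) ^ m \<le> d ^ m \<longleftrightarrow> 1 - q / s \<le> d"
      using s d m by (intro power_mono_iff) auto
    also have "\<dots> \<longleftrightarrow> (1 - d) * s \<le> q" using s by (simp add: field_simps)
    finally show ?thesis using False d by auto
  qed
  also have "\<dots> \<longleftrightarrow> (1 - d) / \<epsilon> k * a k * s \<le> 1"
    using pos by (simp add: q_def field_simps)
  also have "\<dots> \<longleftrightarrow> quad_form (Q2 N a \<epsilon> \<delta> H k) t \<le> 1"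
    unfolding quad_form_Q2[where H = H and k = k, OF H t] m(2) by (simp add: less_eq_complex_def d_def s_def v_def)
  finally show ?thesis .
qed

text \<open>The exponential tail is compared with \<open>\<delta> k\<close> by a logarithm. It
  divides by \<open>(l2norm t)\<^sup>2\<close>, so \<open>t = 0\<close> is separate: there the
  interference vanishes identically and both sides hold.\<close>

lemma constraint3_iff:
  assumes M: "prob_space M" and pos: "a k > 0" "\<epsilon> k > 0" and mn: "m \<ge> 1" "n \<ge> 1"
    and \<delta>: "0 < \<delta> k" "\<delta> k < 1" and G: "iid_cnormal_mat M m n (G k)"
    and R: "random_vec M m (R k)" and unit: "\<forall>\<omega>\<in>space M. R k \<omega> \<in> unit_sphere m"
    and ind: "indep_mat_vec M m n (G k) (R k)" and t: "t \<in> carrier_vec n"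
  shows "constraint3 M a \<epsilon> \<delta> G R k t \<longleftrightarrow> quad_form (Q3 n a \<epsilon> \<delta> k) t \<le> 1"
proof (cases "t = 0\<^sub>v n")
  case True
  interpret prob_space M by fact
  have "interference (a k) (G k \<omega>) (R k \<omega>) t = 0" if "\<omega> \<in> space M" for \<omega>
  proof -
    have "G k \<omega> \<in> carrier_mat m n" "R k \<omega> \<in> carrier_vec m"
      using that G R by (auto simp: iid_cnormal_mat_def random_mat_def random_vec_def)
    then show ?thesis by (simp add: True mult_mat_vec_zero interference_def)
  qed
  then have "{\<omega>\<in>space M. interference (a k) (G k \<omega>) (R k \<omega>) t \<le> \<epsilon> k} = space M"
    using pos by auto
  then have "constraint3 M a \<epsilon> \<delta> G R k t" using \<delta> by (simp add: constraint3_def prob_space)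
  moreover have "l2norm t = 0" using True t l2norm_eq_0_iff by blast
  ultimately show ?thesis by (simp add: quad_form_Q3[OF t] less_eq_complex_def)
next
  case False
  define s where "s = (l2norm t)\<^sup>2"
  have s: "s > 0" using l2norm_eq_0_iff[OF t] False by (simp add: s_def)
  define q where "q = \<epsilon> k / a k"
  have q: "q \<ge> 0" using pos by (simp add: q_def)
  have "interference (a k) (G k \<omega>) (R k \<omega>) t \<le> \<epsilon> k \<longleftrightarrow> (cmod ((G k \<omega> *\<^sub>v t) \<bullet>c R k \<omega>))\<^sup>2 \<le> q" for \<omega>
    using pos by (simp add: interference_def q_def le_divide_eq mult.commute)
  then have "constraint3 M a \<epsilon> \<delta> G R k t \<longleftrightarrow> exp (- (q / s)) \<le> \<delta> k"
    using iid_cnormal_mat_prob[OF M G mn R unit ind t False q] by (simp add: constraint3_def s_def)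
  also have "\<dots> \<longleftrightarrow> - (q / s) \<le> ln (\<delta> k)"
    using ln_ge_iff[OF \<delta>(1)] by simp
  also have "\<dots> \<longleftrightarrow> a k / \<epsilon> k * ln (1 / \<delta> k) * s \<le> 1"
    using s pos \<delta> by (simp add: q_def ln_div field_simps)
  also have "\<dots> \<longleftrightarrow> quad_form (Q3 n a \<epsilon> \<delta> k) t \<le> 1"
    by (simp add: quad_form_Q3[OF t] less_eq_complex_def s_def)
  finally show ?thesis .
qed

theorem mainTheorem1:
  fixes K mS nS :: nat and N :: "nat \<Rightarrow> nat"
    and aSS N0 Pmax :: real and aS aP \<epsilon> \<delta> :: "nat \<Rightarrow> real"
    and HSS :: "complex mat" and h :: "nat \<Rightarrow> complex vec"
    and H :: "nat \<Rightarrow> complex mat" and r :: "nat \<Rightarrow> complex vec"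
    and M :: "'w measure"
    and G :: "nat \<Rightarrow> 'w \<Rightarrow> complex mat" and R :: "nat \<Rightarrow> 'w \<Rightarrow> complex vec"
  defines "\<Phi> \<equiv> Phi_mat nS K aS N0 h"
  defines "A \<equiv> A_mat aSS HSS \<Phi>"
  defines "\<gamma> \<equiv> sinr K aSS aS N0 HSS h"
  assumes "K \<ge> 1" "mS \<ge> 1" "nS \<ge> 1" "\<forall>k\<in>{1..K}. N k \<ge> 1"
    and "aSS > 0" "N0 > 0" "Pmax > 0"
    and "\<forall>k\<in>{1..K}. aS k > 0 \<and> aP k > 0 \<and> \<epsilon> k > 0"
    and "HSS \<in> carrier_mat nS mS" and "\<forall>k\<in>{1..K}. h k \<in> carrier_vec nS"
  shows
    "invertible_mat \<Phi> \<and>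
     \<comment> \<open>(a)\<close>
     (\<forall>t\<in>carrier_vec mS.
        (\<exists>u. is_arg_max (\<gamma> t) (\<lambda>u. u \<in> unit_sphere nS) u \<and>
             complex_of_real (\<gamma> t u) = quad_form A t) \<and>
        (HSS *\<^sub>v t \<noteq> 0\<^sub>v nS \<longrightarrow>
           is_arg_max (\<gamma> t) (\<lambda>u. u \<in> unit_sphere nS)
             (complex_of_real (1 / l2norm (minv \<Phi> *\<^sub>v (HSS *\<^sub>v t)))
                \<cdot>\<^sub>v (minv \<Phi> *\<^sub>v (HSS *\<^sub>v t))))) \<and>
     \<comment> \<open>(b), Scenario 1\<close>
     ((\<forall>k\<in>{1..K}. H k \<in> carrier_mat (N k) mS \<and> r k \<in> unit_sphere (N k)) \<longrightarrow>
        (\<forall>k\<in>{1..K}. \<forall>t\<in>carrier_vec mS.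
           constraint1 aP \<epsilon> H r k t \<longleftrightarrow> quad_form (Q1 aP \<epsilon> H r k) t \<le> 1) \<and>
        same_solutions mS nS K Pmax \<gamma> A (constraint1 aP \<epsilon> H r) (Q1 aP \<epsilon> H r)) \<and>
     \<comment> \<open>(b), Scenario 2\<close>
     (prob_space M \<and>
      (\<forall>k\<in>{1..K}. H k \<in> carrier_mat (N k) mS \<and> N k \<ge> 2 \<and> 0 < \<delta> k \<and> \<delta> k < 1 \<and>
         isotropic_unit_vec M (N k) (R k)) \<longrightarrow>
        (\<forall>k\<in>{1..K}. \<forall>t\<in>carrier_vec mS.
           constraint2 M aP \<epsilon> \<delta> H R k t \<longleftrightarrow> quad_form (Q2 N aP \<epsilon> \<delta> H k) t \<le> 1) \<and>
        same_solutions mS nS K Pmax \<gamma> A (constraint2 M aP \<epsilon> \<delta> H R) (Q2 N aP \<epsilon> \<delta> H)) \<and>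
     \<comment> \<open>(b), Scenario 3\<close>
     (prob_space M \<and>
      (\<forall>k\<in>{1..K}. 0 < \<delta> k \<and> \<delta> k < 1 \<and> iid_cnormal_mat M (N k) mS (G k) \<and>
         random_vec M (N k) (R k) \<and> (\<forall>\<omega>\<in>space M. R k \<omega> \<in> unit_sphere (N k)) \<and>
         indep_mat_vec M (N k) mS (G k) (R k)) \<longrightarrow>
        (\<forall>k\<in>{1..K}. \<forall>t\<in>carrier_vec mS.
           constraint3 M aP \<epsilon> \<delta> G R k t \<longleftrightarrow> quad_form (Q3 mS aP \<epsilon> \<delta> k) t \<le> 1) \<and>
        same_solutions mS nS K Pmax \<gamma> A (constraint3 M aP \<epsilon> \<delta> G R) (Q3 mS aP \<epsilon> \<delta>))"
proof -
  have N0: "N0 > 0" and aSS: "aSS > 0" and HSS: "HSS \<in> carrier_mat nS mS" and nS: "nS \<ge> 1"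
    and h: "\<forall>k\<in>{1..K}. h k \<in> carrier_vec nS" and aS: "\<forall>k\<in>{1..K}. aS k \<ge> 0"
    using assms by (auto simp: less_imp_le)
  have pos: "aP k > 0" "\<epsilon> k > 0" "N k \<ge> 1" if "k \<in> {1..K}" for k using assms that by auto
  have max: "\<forall>t\<in>carrier_vec mS. \<exists>u. is_arg_max (\<gamma> t) (\<lambda>u. u \<in> unit_sphere nS) u \<and>
      complex_of_real (\<gamma> t u) = quad_form A t"
    using ex_is_arg_max_sinr[OF aS N0 h aSS HSS nS] unfolding \<gamma>_def A_def \<Phi>_def by blast
  have receiver: "is_arg_max (\<gamma> t) (\<lambda>u. u \<in> unit_sphere nS)
      (complex_of_real (1 / l2norm (minv \<Phi> *\<^sub>v (HSS *\<^sub>v t))) \<cdot>\<^sub>v (minv \<Phi> *\<^sub>v (HSS *\<^sub>v t)))"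
    if "t \<in> carrier_vec mS" "HSS *\<^sub>v t \<noteq> 0\<^sub>v nS" for t
    using is_arg_max_receiver[OF aS N0 h aSS HSS nS that] unfolding \<gamma>_def \<Phi>_def .
  \<comment> \<open>Common to the three scenarios: the pointwise equivalence of the constraints
    already yields both conclusions.\<close>
  have solve: "(\<forall>k\<in>{1..K}. \<forall>t\<in>carrier_vec mS. I k t \<longleftrightarrow> quad_form (Q k) t \<le> 1) \<and>
      same_solutions mS nS K Pmax \<gamma> A I Q"
    if "\<And>k t. k \<in> {1..K} \<Longrightarrow> t \<in> carrier_vec mS \<Longrightarrow> I k t \<longleftrightarrow> quad_form (Q k) t \<le> 1"
    for I :: "nat \<Rightarrow> complex vec \<Rightarrow> bool" and Q
    using that same_solutionsI[OF _ max, of K I Q Pmax] by blast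
  have inv: "invertible_mat \<Phi>" unfolding \<Phi>_def by (rule Phi_mat_inverse(1)[OF aS N0 h])
  have a: "\<forall>t\<in>carrier_vec mS.
        (\<exists>u. is_arg_max (\<gamma> t) (\<lambda>u. u \<in> unit_sphere nS) u \<and>
             complex_of_real (\<gamma> t u) = quad_form A t) \<and>
        (HSS *\<^sub>v t \<noteq> 0\<^sub>v nS \<longrightarrow>
           is_arg_max (\<gamma> t) (\<lambda>u. u \<in> unit_sphere nS)
             (complex_of_real (1 / l2norm (minv \<Phi> *\<^sub>v (HSS *\<^sub>v t)))
                \<cdot>\<^sub>v (minv \<Phi> *\<^sub>v (HSS *\<^sub>v t))))"
    by (intro ballI conjI impI receiver bspec[OF max])
  show ?thesis
    apply (rule conjI[OF inv], rule conjI[OF a], rule conjI, rule impI, rule solve)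
     apply (rule constraint1_iff[OF pos(1,2)]; blast)
    apply (rule conjI, rule impI, rule solve)
     apply (rule constraint2_iff[OF _ pos(1,2)]; blast)
    apply (rule impI, rule solve)
    apply (rule constraint3_iff[OF _ pos(1,2) pos(3) \<open>mS \<ge> 1\<close>]; blast)
    done
qed
end
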